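(* Let $G$ be a finite graph with $n$ nodes. There is a convex polytope $\mathcal{J}G$ of dimension $n$ (the graph multiplihedron of $G$) whose face poset is isomorphic to the poset $(\text{marked tubings of } G,\preceq)$.
   Context: Graphs are finite, simple, with at least one node. A tube of $G$ is a nonempty set of nodes whose induced subgraph is connected; in addition, the set of all nodes of $G$ (whether or not $G$ is connected) is considered a tube, called the universal tube. Two distinct tubes $u_1,u_2$ intersect if $u_1\cap u_2\ne\emptyset$, $u_1\not\subset u_2$ and $u_2\not\subset u_1$; they are adjacent if $u_1\cap u_2=\emptyset$ and $u_1\cup u_2$ is a tube; they are compatible if they neither intersect nor are adjacent. A tubing of $G$ is a set of pairwise compatible tubes of $G$ that contains the universal tube and, if $G$ is disconnected, does not contain all of the tubes given by the node sets of the connected components of $G$. A marked tubing of $G$ is a tubing together with an assignment to each of its tubes of exactly one of the markings thin, thick, broken, such that whenever $u\subsetneq v$ are tubes of the tubing and $v$ is not thick, then $u$ is thin. In a tubing, $u$ is closely nested in $v$, written $u\Subset v$, if $u\subsetneq v$ and no tube $u'$ of the tubing satisfies $u\subsetneq u'\subsetneq v$. Order on marked tubings: $U\preceq U'$ if $U$ is obtained from $U'$ by a finite (possibly empty) sequence of the following moves, each producing again a marked tubing: (1) a broken tube becomes thin or becomes thick; (2) a thin tube is added inside a thin tube or inside a broken tube; (3) a thick tube is added inside a thick tube; (4) a nonempty collection of compatible broken tubes $\{u_1,\dots,u_m\}$ is added simultaneously inside a broken tube $v$, with $u_i\Subset v$ for all $i$ in the resulting tubing, and at the same time $v$ becomes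 thick. The face poset of a polytope is the set of its nonempty faces (including the polytope itself) ordered by inclusion. *)

theory Defs
  imports "HOL-Analysis.Analysis" "Graph_Theory.Graph_Theory"
begin

text \<open>
  Finite simple graphs are the \<^locale>\<open>graph\<close>s of the library (symmetric, loop-free digraphs
  without multiple arcs). The name of \<^const>\<open>Digraph_Component.connected\<close> is qualified because it competes
  with topological connectedness.
\<close>

definition universal_tube :: "('a, 'b) pre_digraph \<Rightarrow> 'a set" where
  "universal_tube G = verts G"

definition tube :: "('a, 'b) pre_digraph \<Rightarrow> 'a set \<Rightarrow> bool" where
  "tube G u \<longleftrightarrow>
     (u \<subseteq> verts G \<and> u \<noteq> {} \<and> Digraph_Component.connected (G \<restriction> u)) \<or> u = universal_tube G"

definition tubes_intersect :: "'a set \<Rightarrow> 'a set \<Rightarrow> bool" where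
  "tubes_intersect u1 u2 \<longleftrightarrow> u1 \<inter> u2 \<noteq> {} \<and> \<not> u1 \<subset> u2 \<and> \<not> u2 \<subset> u1"

definition tubes_adjacent :: "('a, 'b) pre_digraph \<Rightarrow> 'a set \<Rightarrow> 'a set \<Rightarrow> bool" where
  "tubes_adjacent G u1 u2 \<longleftrightarrow> u1 \<inter> u2 = {} \<and> tube G (u1 \<union> u2)"

definition compatible_tubes :: "('a, 'b) pre_digraph \<Rightarrow> 'a set \<Rightarrow> 'a set \<Rightarrow> bool" where
  "compatible_tubes G u1 u2 \<longleftrightarrow> \<not> tubes_intersect u1 u2 \<and> \<not> tubes_adjacent G u1 u2"

text \<open>The relations above are meant for distinct tubes; \<^const>\<open>pairwise\<close> only compares distinct
  elements. As arcs are symmetric, the strongly connected components are the connected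
  components.\<close>

definition tubing :: "('a, 'b) pre_digraph \<Rightarrow> 'a set set \<Rightarrow> bool" where
  "tubing G T \<longleftrightarrow>
     (\<forall>u\<in>T. tube G u) \<and> pairwise (compatible_tubes G) T \<and> universal_tube G \<in> T \<and>
     (\<not> Digraph_Component.connected G \<longrightarrow> \<not> pre_digraph.sccs_verts G \<subseteq> T)"

definition closely_nested :: "'a set set \<Rightarrow> 'a set \<Rightarrow> 'a set \<Rightarrow> bool" where
  "closely_nested T u v \<longleftrightarrow> u \<subset> v \<and> \<not> (\<exists>u'\<in>T. u \<subset> u' \<and> u' \<subset> v)"

datatype marking = Thin | Thick | Broken

text \<open>A marked tubing is a partial map whose domain is the underlying tubing. This way two marked
  tubings are equal iff they have the same tubes and the same marking of these tubes.\<close>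

definition marked_tubing :: "('a, 'b) pre_digraph \<Rightarrow> ('a set \<rightharpoonup> marking) \<Rightarrow> bool" where
  "marked_tubing G M \<longleftrightarrow>
     tubing G (dom M) \<and>
     (\<forall>u\<in>dom M. \<forall>v\<in>dom M. u \<subset> v \<and> M v \<noteq> Some Thick \<longrightarrow> M u = Some Thin)"

definition marked_tubings :: "('a, 'b) pre_digraph \<Rightarrow> ('a set \<rightharpoonup> marking) set" where
  "marked_tubings G = {M. marked_tubing G M}"

text \<open>\<open>marking_move G M M'\<close>: the marked tubing \<open>M'\<close> arises from the marked tubing \<open>M\<close> by a single
  move, i.e. \<open>M'\<close> is the \<^emph>\<open>smaller\<close> one.\<close>

inductive marking_move ::
  "('a, 'b) pre_digraph \<Rightarrow> ('a set \<rightharpoonup> marking) \<Rightarrow> ('a set \<rightharpoonup> marking) \<Rightarrow> bool"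
  for G :: "('a, 'b) pre_digraph" where
  resolve_broken:
    "\<lbrakk>marked_tubing G M; M u = Some Broken; c = Thin \<or> c = Thick;
      M' = M(u \<mapsto> c); marked_tubing G M'\<rbrakk>
     \<Longrightarrow> marking_move G M M'"
| add_thin:
    "\<lbrakk>marked_tubing G M; u \<notin> dom M; u \<subset> v; M v = Some Thin \<or> M v = Some Broken;
      M' = M(u \<mapsto> Thin); marked_tubing G M'\<rbrakk>
     \<Longrightarrow> marking_move G M M'"
| add_thick:
    "\<lbrakk>marked_tubing G M; u \<notin> dom M; u \<subset> v; M v = Some Thick;
      M' = M(u \<mapsto> Thick); marked_tubing G M'\<rbrakk>
     \<Longrightarrow> marking_move G M M'"
| add_broken:
    "\<lbrakk>marked_tubing G M; M v = Some Broken;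
      B \<noteq> {}; B \<inter> dom M = {}; pairwise (compatible_tubes G) B;
      M' = (\<lambda>w. if w \<in> B then Some Broken else if w = v then Some Thick else M w);
      \<forall>u\<in>B. closely_nested (dom M') u v; marked_tubing G M'\<rbrakk>
     \<Longrightarrow> marking_move G M M'"

definition marked_tubing_le ::
  "('a, 'b) pre_digraph \<Rightarrow> ('a set \<rightharpoonup> marking) \<Rightarrow> ('a set \<rightharpoonup> marking) \<Rightarrow> bool" where
  "marked_tubing_le G U U' \<longleftrightarrow> (marking_move G)\<^sup>*\<^sup>* U' U"

definition polytope_faces :: "'e::euclidean_space set \<Rightarrow> 'e set set" where
  "polytope_faces P = {F. F face_of P \<and> F \<noteq> {}}"

end

(*
  Realize J as the Minkowski sum, over all tubes u, of the polytopes with vertices e_i and 2 e_i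
  (i in u). A nonempty face of J consists of the maximizers of a linear functional c, and it is
  determined by the faces that c selects in the summands, that is, by the nodes of u at which c
  attains its maximum on u and by the sign of this maximum. A functional c has a marked tubing:
  its tubes are those u such that the maximum of c grows strictly whenever u is enlarged to another
  tube, and such a tube is thin, broken or thick if the maximum is negative, zero or positive.
  Every marked tubing arises from a function that increases strictly along the inclusion of tubes.
  Inclusion of faces becomes a comparison of marked tubings (refinement) without reference to
  moves: the tubing grows, and every tube u of the finer one is marked like the smallest tube of
  the coarser one that contains u, unless the latter is broken. If M' is a proper refinement of M, a
  single move brings M closer to M', so refinement is the order generated by the moves.
*)
theory Submission
  imports Defs
begin

section \<open>Faces of Minkowski sums of finite sets\<close>

definition maximizers :: "'e::euclidean_space \<Rightarrow> 'e set \<Rightarrow> 'e set" where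
  "maximizers w S = {x \<in> S. \<forall>y\<in>S. w \<bullet> y \<le> w \<bullet> x}"

text \<open>The summands are finite generating sets and the convex hull is taken only afterwards, so
  points of the sum need not be vertices of the hull.\<close>

definition minkowski_sum :: "'i set \<Rightarrow> ('i \<Rightarrow> 'e::euclidean_space set) \<Rightarrow> 'e set" where
  "minkowski_sum I E = (\<lambda>f. \<Sum>u\<in>I. f u) ` Pi I E"

lemma maximizers_nonempty:
  assumes "finite S" "S \<noteq> {}"
  shows "maximizers w S \<noteq> {}"
proof -
  have "Max ((\<bullet>) w ` S) \<in> (\<bullet>) w ` S" using assms by (intro Max_in) auto
  then obtain x where "x \<in> S" "w \<bullet> x = Max ((\<bullet>) w ` S)" by auto
  then have "x \<in> maximizers w S" using assms by (auto simp: maximizers_def)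
  then show ?thesis by blast
qed

text \<open>\<open>PiE\<close> fixes the values outside \<open>I\<close>, which leaves finitely many
  choice functions when \<open>I\<close> and the summands are finite.\<close>

lemma minkowski_sum_eq_PiE: "minkowski_sum I E = (\<lambda>f. \<Sum>u\<in>I. f u) ` PiE I E"
proof -
  have "(\<Sum>u\<in>I. f u) \<in> (\<lambda>f. \<Sum>u\<in>I. f u) ` PiE I E" if "f \<in> Pi I E" for f
    using that by (intro image_eqI[of _ _ "restrict f I"]) auto
  then show ?thesis by (force simp: minkowski_sum_def)
qed

lemma finite_minkowski_sum:
  assumes "finite I" "\<And>u. u \<in> I \<Longrightarrow> finite (E u)"
  shows "finite (minkowski_sum I E)"
  using assms by (simp add: minkowski_sum_eq_PiE finite_PiE)

lemma minkowski_sum_nonempty: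
  assumes "\<And>u. u \<in> I \<Longrightarrow> E u \<noteq> {}"
  shows "minkowski_sum I E \<noteq> {}"
  using assms by (simp add: minkowski_sum_eq_PiE PiE_eq_empty_iff)

text \<open>Linearity splits the objective over the summands, and the choice at one index can be
  exchanged while all others are kept.\<close>

lemma sum_mem_maximizers_minkowski_sum:
  assumes "finite I" "f \<in> Pi I E" "\<And>u. u \<in> I \<Longrightarrow> finite (E u)"
  shows "sum f I \<in> maximizers w (minkowski_sum I E) \<longleftrightarrow> (\<forall>u\<in>I. f u \<in> maximizers w (E u))"
proof
  assume L: "sum f I \<in> maximizers w (minkowski_sum I E)"
  show "\<forall>u\<in>I. f u \<in> maximizers w (E u)"
  proof
    fix u assume u: "u \<in> I"
    have "w \<bullet> e \<le> w \<bullet> f u" if e: "e \<in> E u" for e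
    proof -
      have "f(u := e) \<in> Pi I E" using assms e by auto
      then have "sum (f(u := e)) I \<in> minkowski_sum I E" unfolding minkowski_sum_def by (rule imageI)
      with L have "w \<bullet> sum (f(u := e)) I \<le> w \<bullet> sum f I" by (auto simp: maximizers_def)
      moreover have "sum (f(u := e)) I = e + sum f (I - {u})"
        by (subst sum.remove[OF assms(1) u]) (auto intro: sum.cong)
      moreover have "sum f I = f u + sum f (I - {u})" by (rule sum.remove[OF assms(1) u])
      ultimately show ?thesis by (simp add: inner_add_right)
    qed
    then show "f u \<in> maximizers w (E u)" using u assms by (auto simp: maximizers_def)
  qed
next
  assume R: "\<forall>u\<in>I. f u \<in> maximizers w (E u)"
  have "w \<bullet> sum g I \<le> w \<bullet> sum f I" if "g \<in> Pi I E" for g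
    unfolding inner_sum_right using R that by (intro sum_mono) (auto simp: maximizers_def)
  then show "sum f I \<in> maximizers w (minkowski_sum I E)"
    using assms(2) by (auto simp: maximizers_def minkowski_sum_def)
qed

text \<open>A maximizer of one summand extends to a maximizer of the sum by choosing maximizers of
  the other summands, which exist by finiteness and nonemptiness. Hence a face of the sum remembers
  the face of every summand.\<close>

lemma maximizers_minkowski_sum_subset_iff:
  assumes "finite I" "\<And>u. u \<in> I \<Longrightarrow> finite (E u)" "\<And>u. u \<in> I \<Longrightarrow> E u \<noteq> {}"
  shows "maximizers w (minkowski_sum I E) \<subseteq> maximizers w' (minkowski_sum I E) \<longleftrightarrow>
    (\<forall>u\<in>I. maximizers w (E u) \<subseteq> maximizers w' (E u))"
proof
  assume L: "maximizers w (minkowski_sum I E) \<subseteq> maximizers w' (minkowski_sum I E)"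
  show "\<forall>u\<in>I. maximizers w (E u) \<subseteq> maximizers w' (E u)"
  proof (intro ballI subsetI)
    fix u e assume u: "u \<in> I" and e: "e \<in> maximizers w (E u)"
    have "maximizers w (E x) \<noteq> {}" if "x \<in> I" for x
      using assms that by (intro maximizers_nonempty) auto
    then have "\<forall>x\<in>I. \<exists>e. e \<in> maximizers w (E x)" by (simp add: ex_in_conv)
    then obtain g where g: "\<forall>x\<in>I. g x \<in> maximizers w (E x)"
      by metis
    define f where "f = g(u := e)"
    have f: "\<forall>x\<in>I. f x \<in> maximizers w (E x)" using g e by (auto simp: f_def)
    then have fP: "f \<in> Pi I E" by (auto simp: maximizers_def)
    have "sum f I \<in> maximizers w (minkowski_sum I E)"
      using sum_mem_maximizers_minkowski_sum[OF assms(1) fP assms(2)] f by simp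
    with L have "sum f I \<in> maximizers w' (minkowski_sum I E)" by blast
    then have "f u \<in> maximizers w' (E u)"
      using sum_mem_maximizers_minkowski_sum[OF assms(1) fP assms(2)] u by simp
    then show "e \<in> maximizers w' (E u)" by (simp add: f_def)
  qed
next
  assume R: "\<forall>u\<in>I. maximizers w (E u) \<subseteq> maximizers w' (E u)"
  show "maximizers w (minkowski_sum I E) \<subseteq> maximizers w' (minkowski_sum I E)"
  proof
    fix x assume x: "x \<in> maximizers w (minkowski_sum I E)"
    then obtain f where f: "f \<in> Pi I E" "x = sum f I"
      by (auto simp: maximizers_def minkowski_sum_def)
    show "x \<in> maximizers w' (minkowski_sum I E)"
      using x R sum_mem_maximizers_minkowski_sum[OF assms(1) f(1) assms(2)] unfolding f(2) by blast
  qed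
qed

section \<open>Faces of a convex hull of finitely many points as sets of maximizers\<close>

lemma inner_le_on_convex_hull:
  assumes "\<And>y. y \<in> X \<Longrightarrow> w \<bullet> y \<le> b" "x \<in> convex hull X"
  shows "w \<bullet> x \<le> b"
proof -
  have "convex hull X \<subseteq> {x. w \<bullet> x \<le> b}"
    by (rule hull_minimal) (use assms convex_halfspace_le in auto)
  then show ?thesis using assms by auto
qed

text \<open>A linear functional has the same upper bounds on \<open>X\<close> and on its convex
  hull.\<close>

lemma maximizers_convex_hull_Int: "maximizers w (convex hull X) \<inter> X = maximizers w X"
proof -
  have "w \<bullet> y \<le> w \<bullet> x" if "\<forall>z\<in>X. w \<bullet> z \<le> w \<bullet> x" "y \<in> convex hull X" for x y
    using that by (auto intro: inner_le_on_convex_hull[OF _ that(2)])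
  then show ?thesis using hull_subset[of X convex] unfolding maximizers_def by blast
qed

lemma maximizers_face_of:
  assumes "convex S"
  shows "maximizers w S face_of S"
proof (cases "maximizers w S = {}")
  case False
  then obtain x where x: "x \<in> maximizers w S" by blast
  then have "maximizers w S = S \<inter> {y. w \<bullet> y = w \<bullet> x}"
    by (auto simp: maximizers_def intro: antisym)
  then show ?thesis
    using x assms by (auto simp: maximizers_def intro: face_of_Int_supporting_hyperplane_le)
qed auto

text \<open>A face of the hull is itself the hull of some points of \<open>X\<close>, and these are
  maximizers in \<open>X\<close>. As faces are convex, comparing these generators suffices.\<close>

lemma maximizers_convex_hull_subset_iff:
  assumes "finite X"
  shows "maximizers w (convex hull X) \<subseteq> maximizers w' (convex hull X) \<longleftrightarrow>
    maximizers w X \<subseteq> maximizers w' X"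
proof
  assume "maximizers w (convex hull X) \<subseteq> maximizers w' (convex hull X)"
  then show "maximizers w X \<subseteq> maximizers w' X"
    using maximizers_convex_hull_Int by blast
next
  assume R: "maximizers w X \<subseteq> maximizers w' X"
  obtain X' where X': "X' \<subseteq> X" "maximizers w (convex hull X) = convex hull X'"
    using face_of_convex_hull_subset[OF finite_imp_compact[OF assms]
        maximizers_face_of[OF convex_convex_hull]] by metis
  have "X' \<subseteq> maximizers w X"
    using X' hull_subset[of X' convex] maximizers_convex_hull_Int[of w X] by blast
  also have "\<dots> \<subseteq> maximizers w' (convex hull X)"
    using R maximizers_convex_hull_Int[of w' X] by blast
  finally show "maximizers w (convex hull X) \<subseteq> maximizers w' (convex hull X)"
    unfolding X'(2)
    by (intro hull_minimal face_of_imp_convex[OF maximizers_face_of[OF convex_convex_hull]])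
qed

text \<open>All faces of a polyhedron are exposed, and a nonempty exposed face attains the bound of
  its supporting halfspace. The zero functional yields the whole polytope.\<close>

lemma polytope_faces_eq_maximizers:
  assumes "finite X" "X \<noteq> {}"
  shows "polytope_faces (convex hull X) = range (\<lambda>w. maximizers w (convex hull X))"
proof (intro equalityI subsetI)
  fix F assume "F \<in> polytope_faces (convex hull X)"
  then have F: "F exposed_face_of convex hull X" "F \<noteq> {}"
    using exposed_face_of_polyhedron[OF polyhedron_convex_hull[OF assms(1)]]
    by (auto simp: polytope_faces_def)
  then obtain a b where ab: "convex hull X \<subseteq> {x. a \<bullet> x \<le> b}" "F = convex hull X \<inter> {x. a \<bullet> x = b}"
    by (auto simp: exposed_face_of_def)
  obtain z where "z \<in> convex hull X" "a \<bullet> z = b" using ab F(2) by blast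
  moreover have "a \<bullet> y \<le> b" if "y \<in> convex hull X" for y using that ab by blast
  ultimately have "F = maximizers a (convex hull X)"
    unfolding ab(2) maximizers_def by (auto intro: antisym)
  then show "F \<in> range (\<lambda>w. maximizers w (convex hull X))" by blast
next
  fix F assume "F \<in> range (\<lambda>w. maximizers w (convex hull X))"
  then obtain w where w: "F = maximizers w (convex hull X)" by blast
  have "maximizers w X \<noteq> {}" using assms by (rule maximizers_nonempty)
  then have "F \<noteq> {}" using w maximizers_convex_hull_Int[of w X] by blast
  then show "F \<in> polytope_faces (convex hull X)"
    using w maximizers_face_of[OF convex_convex_hull] by (auto simp: polytope_faces_def)
qed

text \<open>A set of smaller dimension lies in a hyperplane, and the normal vector of that
  hyperplane is a nonzero functional constant on the set.\<close>

lemma aff_dim_full_if_maximizers_proper: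
  fixes S :: "'e::euclidean_space set"
  assumes "\<And>w. w \<noteq> 0 \<Longrightarrow> maximizers w S \<noteq> S"
  shows "aff_dim S = int (DIM('e))"
proof (rule ccontr)
  assume "\<not> ?thesis"
  then have "aff_dim S < DIM('e)" using aff_dim_le_DIM[of S] by linarith
  then obtain a b where ab: "a \<noteq> 0" "S \<subseteq> {x. a \<bullet> x = b}" by (rule aff_lowdim_subset_hyperplane)
  then have "a \<bullet> x = b" if "x \<in> S" for x using that by blast
  then have "maximizers a S = S" by (auto simp: maximizers_def)
  with ab assms show False by blast
qed

section \<open>Marked tubings and linear functionals\<close>

definition peak :: "('a \<Rightarrow> real) \<Rightarrow> 'a set \<Rightarrow> real" where
  "peak c u = Max (c ` u)"

definition sign_marking :: "real \<Rightarrow> marking" where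
  "sign_marking r = (if r < 0 then Thin else if r = 0 then Broken else Thick)"

definition height_marking ::
  "('a, 'b) pre_digraph \<Rightarrow> ('a \<Rightarrow> real) \<Rightarrow> ('a set \<rightharpoonup> marking)" where
  "height_marking G c = (\<lambda>u. if tube G u \<and> (\<forall>v. tube G v \<longrightarrow> u \<subset> v \<longrightarrow> peak c u < peak c v)
     then Some (sign_marking (peak c u)) else None)"

text \<open>For a tubing this intersection is itself a member, the smallest tube of \<open>T\<close>
  around \<open>u\<close> (\<open>tube_hull_mem\<close>). As an intersection it is monotone and
  minimal for every family \<open>T\<close>.\<close>

definition tube_hull :: "'a set set \<Rightarrow> 'a set \<Rightarrow> 'a set" where
  "tube_hull T u = \<Inter>{v \<in> T. u \<subseteq> v}"

text \<open>The closed form of \<^const>\<open>marked_tubing_le\<close>.\<close>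

definition marking_refines :: "('a set \<rightharpoonup> marking) \<Rightarrow> ('a set \<rightharpoonup> marking) \<Rightarrow> bool" where
  "marking_refines M' M \<longleftrightarrow> dom M \<subseteq> dom M' \<and>
     (\<forall>u\<in>dom M'. M (tube_hull (dom M) u) = M' u \<or> M (tube_hull (dom M) u) = Some Broken)"

lemma peak_ge: "finite u \<Longrightarrow> i \<in> u \<Longrightarrow> c i \<le> peak c u"
  by (simp add: peak_def)

lemma peak_attained: "finite u \<Longrightarrow> u \<noteq> {} \<Longrightarrow> \<exists>i\<in>u. c i = peak c u"
  using Max_in[of "c ` u"] unfolding peak_def by (metis finite_imageI imageE image_is_empty)

lemma tube_hull_superset: "u \<subseteq> tube_hull T u"
  by (auto simp: tube_hull_def)

lemma tube_hull_least: "x \<in> T \<Longrightarrow> u \<subseteq> x \<Longrightarrow> tube_hull T u \<subseteq> x"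
  by (auto simp: tube_hull_def)

lemma tube_hull_self: "u \<in> T \<Longrightarrow> tube_hull T u = u"
  by (auto simp: tube_hull_def)

lemma tube_hull_mono: "u \<subseteq> v \<Longrightarrow> tube_hull T u \<subseteq> tube_hull T v"
  by (auto simp: tube_hull_def)

lemma refines_refl: "marking_refines M M"
  by (auto simp: marking_refines_def tube_hull_self)

text \<open>The domains agree, so all hulls are trivial, and a tube with two different markings
  would have to be \<open>Broken\<close> in both maps.\<close>

lemma refines_antisym:
  assumes "marking_refines M M'" "marking_refines M' M"
  shows "M = M'"
proof
  fix u
  have dom: "dom M = dom M'" using assms by (auto simp: marking_refines_def)
  show "M u = M' u"
  proof (cases "u \<in> dom M")
    case True
    then have "tube_hull (dom M) u = u" by (rule tube_hull_self)
    then have "M' u = M u \<or> M' u = Some Broken" "M u = M' u \<or> M u = Some Broken"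
      using assms True dom unfolding marking_refines_def by metis+
    then show ?thesis by auto
  next
    case False
    then show ?thesis using dom by (metis domIff)
  qed
qed

lemma finite_maximal_set:
  assumes "finite A" "a \<in> A"
  shows "\<exists>m\<in>A. \<forall>y\<in>A. m \<subseteq> y \<longrightarrow> m = y"
  using finite_has_maximal2[OF assms] by metis

section \<open>Connectedness in terms of cuts\<close>

lemma (in graph) sym_arc: "(a, b) \<in> arcs_ends G \<longleftrightarrow> (b, a) \<in> arcs_ends G"
  using sym_arcs by (auto simp: symmetric_def dest: symD)

lemma (in graph) arcs_ends_induce_subgraph:
  "arcs_ends (G \<restriction> u) = {(a, b) \<in> arcs_ends G. a \<in> u \<and> b \<in> u}"
  by (auto simp: arcs_ends_def arc_to_ends_def induce_subgraph_def)

text \<open>If some node of \<open>u\<close> is not reachable from \<open>x\<close> inside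
  \<open>u\<close>, the reachable nodes form a side of a cut that no arc leaves. Conversely, a walk
  cannot leave a side without outgoing arcs. Symmetry of the arcs makes the symmetric closure in the
  definition of connectedness trivial.\<close>

lemma (in graph) connected_induce_iff_cut:
  assumes "u \<subseteq> verts G"
  shows "Digraph_Component.connected (G \<restriction> u) \<longleftrightarrow>
    u \<noteq> {} \<and> (\<forall>A. A \<noteq> {} \<longrightarrow> A \<subset> u \<longrightarrow> (\<exists>a\<in>A. \<exists>b\<in>u - A. (a, b) \<in> arcs_ends G))"
proof -
  let ?R = "{(a, b) \<in> arcs_ends G. a \<in> u \<and> b \<in> u}"
  have "symcl ?R = ?R" using sym_arc by (auto simp: symcl_def)
  then have eq: "Digraph_Component.connected (G \<restriction> u) \<longleftrightarrow>
      u \<noteq> {} \<and> (\<forall>x\<in>u. \<forall>y\<in>u. (x, y) \<in> rtrancl_on u ?R)"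
    unfolding connected_conv arcs_ends_induce_subgraph by simp
  have reach: "(x, y) \<in> rtrancl_on u ?R"
    if cut: "\<forall>A. A \<noteq> {} \<longrightarrow> A \<subset> u \<longrightarrow> (\<exists>a\<in>A. \<exists>b\<in>u - A. (a, b) \<in> arcs_ends G)" and "x \<in> u" "y \<in> u" for x y
  proof (rule ccontr)
    assume ne: "(x, y) \<notin> rtrancl_on u ?R"
    let ?A = "{z \<in> u. (x, z) \<in> rtrancl_on u ?R}"
    have "x \<in> ?A" using that by auto
    moreover have "?A \<subset> u" using that ne by auto
    ultimately obtain a b where ab: "a \<in> ?A" "b \<in> u - ?A" "(a, b) \<in> arcs_ends G"
      using cut[rule_format, of ?A] by blast
    then have "(x, b) \<in> rtrancl_on u ?R"
      by (auto intro: rtrancl_on_into_rtrancl_on)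
    with ab show False by auto
  qed
  have cut: "\<exists>a\<in>A. \<exists>b\<in>u - A. (a, b) \<in> arcs_ends G"
    if conn: "\<forall>x\<in>u. \<forall>y\<in>u. (x, y) \<in> rtrancl_on u ?R" and A: "A \<noteq> {}" "A \<subset> u" for A
  proof (rule ccontr)
    assume no: "\<not> ?thesis"
    obtain x y where xy: "x \<in> A" "y \<in> u" "y \<notin> A" using A by blast
    have "b \<in> A" if "(a, b) \<in> rtrancl_on u ?R" "a \<in> A" for a b
      using that by (induction rule: rtrancl_on.induct) (use no in auto)
    moreover have "(x, y) \<in> rtrancl_on u ?R" using conn A xy by blast
    ultimately show False using xy by blast
  qed
  show ?thesis unfolding eq
  proof (intro conj_cong refl iffI allI impI ballI)
    fix A assume "\<forall>x\<in>u. \<forall>y\<in>u. (x, y) \<in> rtrancl_on u ?R" "A \<noteq> {}" "A \<subset> u"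
    then show "\<exists>a\<in>A. \<exists>b\<in>u - A. (a, b) \<in> arcs_ends G" by (rule cut)
  next
    fix x y
    assume "\<forall>A. A \<noteq> {} \<longrightarrow> A \<subset> u \<longrightarrow> (\<exists>a\<in>A. \<exists>b\<in>u - A. (a, b) \<in> arcs_ends G)" "x \<in> u" "y \<in> u"
    then show "(x, y) \<in> rtrancl_on u ?R" by (rule reach)
  qed
qed

section \<open>Tubes, connected sets and components\<close>

locale nonempty_graph = graph +
  assumes verts_nonempty: "verts G \<noteq> {}"
begin

text \<open>Tubes without the exception for the universal tube; the two notions differ only on the
  node set of a disconnected graph (\<open>tube_iff\<close>).\<close>

definition conn :: "'a set \<Rightarrow> bool" where
  "conn u \<longleftrightarrow> u \<subseteq> verts G \<and> Digraph_Component.connected (G \<restriction> u)"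

lemma conn_iff_cut: "conn u \<longleftrightarrow> u \<subseteq> verts G \<and> u \<noteq> {} \<and>
    (\<forall>A. A \<noteq> {} \<longrightarrow> A \<subset> u \<longrightarrow> (\<exists>a\<in>A. \<exists>b\<in>u - A. (a, b) \<in> arcs_ends G))"
  unfolding conn_def by (rule conj_cong[OF refl connected_induce_iff_cut])

text \<open>A set \<open>A\<close> that splits \<open>u\<close> or \<open>v\<close> has an outgoing
  arc there. Otherwise it contains or avoids each of them entirely, and a common node forces the
  same alternative for both, so \<open>A\<close> is not a proper nonempty part of the union.\<close>

lemma conn_Un:
  assumes "conn u" "conn v" "u \<inter> v \<noteq> {}"
  shows "conn (u \<union> v)"
proof -
  have "\<exists>a\<in>A. \<exists>b\<in>u \<union> v - A. (a, b) \<in> arcs_ends G" if A: "A \<noteq> {}" "A \<subset> u \<union> v" for A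
  proof -
    have cut: "\<exists>a\<in>A. \<exists>b\<in>u \<union> v - A. (a, b) \<in> arcs_ends G"
      if x: "conn x" "x \<subseteq> u \<union> v" "A \<inter> x \<noteq> {}" "\<not> x \<subseteq> A" for x
    proof -
      have "A \<inter> x \<subset> x" using x by blast
      then obtain a b where "a \<in> A \<inter> x" "b \<in> x - A \<inter> x" "(a, b) \<in> arcs_ends G"
        using x unfolding conn_iff_cut by meson
      then show ?thesis using x by blast
    qed
    show ?thesis
    proof (cases "(A \<inter> u \<noteq> {} \<and> \<not> u \<subseteq> A) \<or> (A \<inter> v \<noteq> {} \<and> \<not> v \<subseteq> A)")
      case True
      then show ?thesis using cut assms by blast
    next
      case False
      then show ?thesis using A assms(3) by blast
    qed
  qed
  moreover have "u \<union> v \<subseteq> verts G" "u \<union> v \<noteq> {}" using assms by (auto simp: conn_def)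
  ultimately show ?thesis unfolding conn_iff_cut[of "u \<union> v"] by simp
qed

lemma conn_singleton: "i \<in> verts G \<Longrightarrow> conn {i}"
  unfolding conn_iff_cut[of "{i}"] by auto

text \<open>The two ends of the arc form a connected set meeting both \<open>u\<close> and
  \<open>v\<close>, through which \<open>conn_Un\<close> glues twice.\<close>

lemma conn_Un_arc:
  assumes "conn u" "conn v" "a \<in> u" "b \<in> v" "(a, b) \<in> arcs_ends G"
  shows "conn (u \<union> v)"
proof -
  have "conn {a, b}"
  proof -
    have "A = {a} \<or> A = {b}" if "A \<noteq> {}" "A \<subset> {a, b}" for A using that by blast
    then have "\<exists>x\<in>A. \<exists>y\<in>{a, b} - A. (x, y) \<in> arcs_ends G"
      if A: "A \<noteq> {}" "A \<subset> {a, b}" for A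
      using that assms sym_arc[of a b] by blast
    moreover have "a \<in> verts G" "b \<in> verts G" using assms by (auto simp: conn_def)
    ultimately show ?thesis unfolding conn_iff_cut[of "{a, b}"] by simp
  qed
  then have "conn ((u \<union> {a, b}) \<union> v)" using assms by (intro conn_Un) auto
  moreover have "(u \<union> {a, b}) \<union> v = u \<union> v" using assms by blast
  ultimately show ?thesis by simp
qed

lemma tube_iff: "tube G u \<longleftrightarrow> conn u \<or> u = verts G"
  by (auto simp: tube_def conn_def universal_tube_def conn_iff_cut connected_conv)

lemma tube_subset: "tube G u \<Longrightarrow> u \<subseteq> verts G"
  and tube_nonempty: "tube G u \<Longrightarrow> u \<noteq> {}"
  and tube_singleton: "i \<in> verts G \<Longrightarrow> tube G {i}"
  using verts_nonempty conn_singleton by (auto simp: tube_iff conn_iff_cut)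

lemma tube_verts: "tube G (verts G)" by (simp add: tube_iff)

lemma finite_tube: "tube G u \<Longrightarrow> finite u"
  by (rule finite_subset[OF tube_subset finite_verts])

lemma finite_tubes: "finite {u. tube G u}"
  by (rule finite_subset[of _ "Pow (verts G)"]) (use tube_subset in auto)

lemma tube_Un: "tube G u \<Longrightarrow> tube G v \<Longrightarrow> u \<inter> v \<noteq> {} \<Longrightarrow> tube G (u \<union> v)"
  using conn_Un[of u v] tube_subset[of u] tube_subset[of v] unfolding tube_iff by blast

lemma connected_iff_conn: "Digraph_Component.connected G \<longleftrightarrow> conn (verts G)"
proof -
  have "arcs_ends (G \<restriction> verts G) = arcs_ends G"
    using arcs_ends_induce_subgraph by auto
  then show ?thesis by (simp add: conn_def connected_conv)
qed

text \<open>A walk between two nodes of a component stays in the component because arcs are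
  symmetric, so it must cross every cut of the component.\<close>

lemma conn_scc:
  assumes "C \<in> sccs_verts"
  shows "conn C"
proof -
  have C: "C \<subseteq> verts G" using sccs_verts_subsets assms by blast
  have "\<exists>a\<in>A. \<exists>b\<in>C - A. (a, b) \<in> arcs_ends G" if A: "A \<noteq> {}" "A \<subset> C" for A
  proof (rule ccontr)
    assume no: "\<not> ?thesis"
    obtain x y where xy: "x \<in> A" "y \<in> C" "y \<notin> A" using A by blast
    then have "x \<in> C" using A by blast
    then have r: "x \<rightarrow>\<^sup>*\<^bsub>G\<^esub> y" using assms xy by (auto simp: in_sccs_verts_conv_reachable)
    have "x \<rightarrow>\<^sup>*\<^bsub>G\<^esub> y \<Longrightarrow> y \<in> A"
    proof (induction rule: reachable_induct)
      case base then show ?case using xy by simp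
    next
      case (step z w)
      have "x \<rightarrow>\<^sup>*\<^bsub>G\<^esub> w" using step by (auto intro: reachable_adj_trans)
      moreover have "w \<rightarrow>\<^sup>*\<^bsub>G\<^esub> x"
        using \<open>x \<rightarrow>\<^sup>*\<^bsub>G\<^esub> w\<close> symmetric_reachable[OF sym_arcs] by blast
      ultimately have "w \<in> C" using assms \<open>x \<in> C\<close> by (auto simp: in_sccs_verts_conv_reachable)
      then show ?case using step no by blast
    qed
    with r xy show False by blast
  qed
  moreover have "C \<noteq> {}" using assms by (simp add: in_sccs_verts_conv_reachable)
  ultimately show ?thesis using C unfolding conn_iff_cut[of C] by simp
qed

lemma conn_subset_scc:
  assumes "C \<in> sccs_verts" "conn x" "C \<inter> x \<noteq> {}"
  shows "x \<subseteq> C"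
proof (rule ccontr)
  assume "\<not> x \<subseteq> C"
  then have "C \<inter> x \<subset> x" by blast
  then obtain a b where ab: "a \<in> C \<inter> x" "b \<in> x - C \<inter> x" "(a, b) \<in> arcs_ends G"
    using assms unfolding conn_iff_cut by meson
  then have "a \<rightarrow>\<^sup>*\<^bsub>G\<^esub> b" "b \<rightarrow>\<^sup>*\<^bsub>G\<^esub> a" using sym_arc by auto
  then show False using assms(1) ab unfolding in_sccs_verts_conv_reachable by blast
qed

lemma scc_exists: "i \<in> verts G \<Longrightarrow> \<exists>C\<in>sccs_verts. i \<in> C"
  using scc_of_in_sccs_verts in_scc_of_self by blast

section \<open>Tubings and the hull of a set in a tubing\<close>

lemma tubingD:
  assumes "tubing G T"
  shows "u \<in> T \<Longrightarrow> tube G u" "verts G \<in> T"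
    "\<not> conn (verts G) \<Longrightarrow> \<exists>C\<in>sccs_verts. C \<notin> T"
    "u \<in> T \<Longrightarrow> v \<in> T \<Longrightarrow> u \<inter> v \<noteq> {} \<Longrightarrow> u \<subseteq> v \<or> v \<subseteq> u"
    "u \<in> T \<Longrightarrow> v \<in> T \<Longrightarrow> u \<inter> v = {} \<Longrightarrow> \<not> tube G (u \<union> v)"
proof -
  show "u \<in> T \<Longrightarrow> tube G u" "verts G \<in> T"
    "\<not> conn (verts G) \<Longrightarrow> \<exists>C\<in>sccs_verts. C \<notin> T"
    using assms connected_iff_conn by (auto simp: tubing_def universal_tube_def)
  have c: "compatible_tubes G u v" if "u \<in> T" "v \<in> T" "u \<noteq> v" for u v
    using assms that by (auto simp: tubing_def pairwise_def)
  show "u \<in> T \<Longrightarrow> v \<in> T \<Longrightarrow> u \<inter> v \<noteq> {} \<Longrightarrow> u \<subseteq> v \<or> v \<subseteq> u"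
    using c[of u v] unfolding compatible_tubes_def tubes_intersect_def by blast
  \<comment> \<open>Distinctness comes for free: tubes are nonempty, so disjoint tubes
    differ.\<close>
  show "u \<in> T \<Longrightarrow> v \<in> T \<Longrightarrow> u \<inter> v = {} \<Longrightarrow> \<not> tube G (u \<union> v)"
    using c[of u v] assms tube_nonempty
    unfolding compatible_tubes_def tubes_adjacent_def tubing_def by blast
qed

lemma finite_tubing: "tubing G T \<Longrightarrow> finite T"
  by (rule finite_subset[OF _ finite_tubes]) (auto simp: tubing_def)

text \<open>Every condition other than containing the universal tube passes to subsets, including
  the one that forbids having all components.\<close>

lemma tubing_subset: "tubing G T' \<Longrightarrow> T \<subseteq> T' \<Longrightarrow> verts G \<in> T \<Longrightarrow> tubing G T"
  unfolding tubing_def universal_tube_def using pairwise_subset[of _ T' T] by blast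

text \<open>The tubes of \<open>T\<close> that contain a nonempty \<open>u\<close> meet pairwise and
  hence form a finite chain, whose least member is the intersection.\<close>

lemma tube_hull_mem:
  assumes T: "tubing G T" and u: "u \<noteq> {}" "u \<subseteq> verts G"
  shows "tube_hull T u \<in> T"
proof -
  let ?A = "{v \<in> T. u \<subseteq> v}"
  have "finite ?A" "?A \<noteq> {}" using finite_tubing[OF T] tubingD(2)[OF T] u by auto
  then obtain m where m: "m \<in> ?A" "\<And>x. x \<in> ?A \<Longrightarrow> x \<subseteq> m \<Longrightarrow> x = m"
    using finite_has_minimal[of ?A] by metis
  have "m \<subseteq> x" if "x \<in> ?A" for x
    using tubingD(4)[OF T, of x m] that m u by blast
  then have "tube_hull T u = m" using m by (auto simp: tube_hull_def)
  then show ?thesis using m by simp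
qed

lemma tube_hull_mem_tube: "tubing G T \<Longrightarrow> tube G u \<Longrightarrow> tube_hull T u \<in> T"
  by (rule tube_hull_mem[OF _ tube_nonempty tube_subset])

text \<open>The hull in the finer family lies between \<open>u\<close> and the hull in the coarser
  one.\<close>

lemma tube_hull_hull:
  assumes "tubing G T" "T \<subseteq> T'" "tube G u"
  shows "tube_hull T (tube_hull T' u) = tube_hull T u"
proof
  have h: "tube_hull T u \<in> T"
    by (rule tube_hull_mem_tube[OF assms(1,3)])
  have "tube_hull T' u \<subseteq> tube_hull T u"
    using h assms by (intro tube_hull_least tube_hull_superset) auto
  then show "tube_hull T (tube_hull T' u) \<subseteq> tube_hull T u" using h tube_hull_least by blast
  show "tube_hull T u \<subseteq> tube_hull T (tube_hull T' u)"
    by (intro tube_hull_mono tube_hull_superset)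
qed

text \<open>Otherwise the tubes properly inside the hull of \<open>u\<close> cover \<open>u\<close>, and an arc of the connected
  set \<open>u\<close> leaving a maximal one of them leads into a tube adjacent to it.\<close>

lemma tube_hull_attained_conn:
  assumes T: "tubing G T" and u: "conn u"
  shows "\<exists>i\<in>u. tube_hull T {i} = tube_hull T u"
proof (rule ccontr)
  let ?h = "tube_hull T u"
  assume neg: "\<not> ?thesis"
  have uV: "u \<subseteq> verts G" "u \<noteq> {}" using u by (auto simp: conn_iff_cut)
  have hT: "?h \<in> T" using T uV tube_hull_mem by blast
  have iT: "tube_hull T {i} \<in> T" if "i \<in> u" for i
    using that uV T by (intro tube_hull_mem) auto
  have sub: "tube_hull T {i} \<subset> ?h" if "i \<in> u" for i
    using neg that tube_hull_mono[of "{i}" u T] by blast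
  obtain i where i: "i \<in> u" using uV by blast
  let ?A = "{x \<in> T. i \<in> x \<and> x \<subset> ?h}"
  have mem: "tube_hull T {i} \<in> ?A" using i iT sub tube_hull_superset[of "{i}" T] by blast
  have fin: "finite ?A" using finite_tubing[OF T] by auto
  obtain x where "x \<in> ?A" "\<forall>y\<in>?A. x \<subseteq> y \<longrightarrow> x = y"
    using finite_maximal_set[OF fin mem] by (elim bexE) blast
  then have x: "x \<in> T" "i \<in> x" "x \<subset> ?h"
    and x_max: "\<And>y. y \<in> T \<Longrightarrow> i \<in> y \<Longrightarrow> y \<subset> ?h \<Longrightarrow> x \<subseteq> y \<Longrightarrow> x = y"
    by blast+
  have "\<not> u \<subseteq> x" using x tube_hull_least[of x T u] by blast
  then have "u \<inter> x \<subset> u" by blast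
  moreover have "u \<inter> x \<noteq> {}" using i x by blast
  ultimately obtain j k where jk: "j \<in> u \<inter> x" "k \<in> u - u \<inter> x" "(j, k) \<in> arcs_ends G"
    using u unfolding conn_iff_cut by meson
  let ?y = "tube_hull T {k}"
  have y: "?y \<in> T" "k \<in> ?y" "?y \<subset> ?h"
    using jk iT sub tube_hull_superset[of "{k}" T] by blast+
  have disj: "x \<inter> ?y = {}"
  proof (rule ccontr)
    assume "x \<inter> ?y \<noteq> {}"
    then have "x \<subseteq> ?y \<or> ?y \<subseteq> x" using tubingD(4)[OF T, of x ?y] x y by blast
    then show False using x_max[of ?y] x y jk by blast
  qed
  \<comment> \<open>A tube properly inside another tube is not universal, so it is connected even if
    the graph is not.\<close>
  have "conn z" if "z \<in> T" "z \<subset> ?h" for z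
    using that tubingD(1)[OF T, of z] tube_subset[OF tubingD(1)[OF T hT]] unfolding tube_iff by blast
  then have "conn x" "conn ?y" using x y by blast+
  then have "conn (x \<union> ?y)" using jk y by (intro conn_Un_arc[of x ?y j k]) auto
  then show False using tubingD(5)[OF T x(1) y(1) disj] by (simp add: tube_iff)
qed

text \<open>Only the universal tube of a disconnected graph is left. Some component is missing from
  the tubing, its hull is universal, and the connected case applies to that component.\<close>

lemma tube_hull_attained:
  assumes T: "tubing G T" and u: "tube G u"
  shows "\<exists>i\<in>u. tube_hull T {i} = tube_hull T u"
proof (cases "conn u")
  case True
  then show ?thesis using tube_hull_attained_conn T by blast
next
  case False
  then have uV: "u = verts G" using u by (simp add: tube_iff)
  have hV: "tube_hull T (verts G) = verts G" using tubingD(2)[OF T] by (rule tube_hull_self)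
  obtain C where C: "C \<in> sccs_verts" "C \<notin> T" using False uV tubingD(3)[OF T] by blast
  have cC: "conn C" using C conn_scc by blast
  then have CV: "C \<subseteq> verts G" "C \<noteq> {}" by (auto simp: conn_iff_cut)
  let ?x = "tube_hull T C"
  have x: "?x \<in> T" "C \<subseteq> ?x"
    by (rule tube_hull_mem[OF T CV(2,1)], rule tube_hull_superset)
  \<comment> \<open>A smaller hull would be connected and hence contained in the component
    \<open>C\<close>, which would put \<open>C\<close> into \<open>T\<close>.\<close>
  have "?x = verts G"
  proof (rule ccontr)
    assume "?x \<noteq> verts G"
    then have "conn ?x" using x tubingD(1)[OF T] by (auto simp: tube_iff)
    then have "?x \<subseteq> C" using conn_subset_scc C CV x by blast
    then show False using x C by (metis subset_antisym)
  qed
  then show ?thesis using tube_hull_attained_conn[OF T cC] CV uV hV by auto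
qed

section \<open>Marked tubings from functionals, and functionals from marked tubings\<close>

lemma peak_mono: "tube G v \<Longrightarrow> u \<subseteq> v \<Longrightarrow> u \<noteq> {} \<Longrightarrow> peak c u \<le> peak c v"
  unfolding peak_def using finite_tube[of v] by (intro Max_mono) auto

lemma peak_Un:
  assumes "tube G u" "tube G v"
  shows "peak c (u \<union> v) = peak c u \<or> peak c (u \<union> v) = peak c v"
proof -
  have "peak c (u \<union> v) = max (peak c u) (peak c v)"
    unfolding peak_def image_Un using assms finite_tube tube_nonempty by (intro Max_Un) auto
  then show ?thesis by (simp add: max_def)
qed

lemma dom_height_marking:
  "u \<in> dom (height_marking G c) \<longleftrightarrow>
    tube G u \<and> (\<forall>v. tube G v \<longrightarrow> u \<subset> v \<longrightarrow> peak c u < peak c v)"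
  by (simp add: height_marking_def dom_def)

lemma height_marking_Some:
  "u \<in> dom (height_marking G c) \<Longrightarrow> height_marking G c u = Some (sign_marking (peak c u))"
  by (auto simp: height_marking_def split: if_splits)

text \<open>The maximum over a union is attained in one of the parts, so two incomparable tubes
  whose union is a tube cannot both have a strictly smaller maximum. In a disconnected graph, a
  component attaining the global maximum is excluded for the same reason. Strict growth also makes
  the maximum negative below a nonpositive one, hence thin below thin or broken.\<close>

lemma marked_tubing_height_marking: "marked_tubing G (height_marking G c)"
proof -
  let ?T = "dom (height_marking G c)"
  have noUn: "\<not> tube G (u \<union> v)" if uv: "u \<in> ?T" "v \<in> ?T" "\<not> u \<subseteq> v" "\<not> v \<subseteq> u" for u v
  proof
    assume t: "tube G (u \<union> v)"
    have "u \<subset> u \<union> v" "v \<subset> u \<union> v" using uv by blast+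
    then have "peak c u < peak c (u \<union> v)" "peak c v < peak c (u \<union> v)"
      using uv t unfolding dom_height_marking by blast+
    moreover have "tube G u" "tube G v" using uv unfolding dom_height_marking by blast+
    ultimately show False using peak_Un[of u v c] by auto
  qed
  have "compatible_tubes G u v" if "u \<in> ?T" "v \<in> ?T" "u \<noteq> v" for u v
  proof -
    have t: "tube G u" "tube G v" using that unfolding dom_height_marking by blast+
    have "\<not> tubes_intersect u v"
      using noUn[of u v] that tube_Un[OF t] unfolding tubes_intersect_def by blast
    moreover have "\<not> tubes_adjacent G u v"
      using noUn[of u v] that tube_nonempty[OF t(1)] tube_nonempty[OF t(2)]
      unfolding tubes_adjacent_def by blast
    ultimately show ?thesis by (simp add: compatible_tubes_def)
  qed
  moreover have "verts G \<in> ?T"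
    unfolding dom_height_marking using tube_verts tube_subset by blast
  moreover have "\<not> sccs_verts \<subseteq> ?T" if nc: "\<not> Digraph_Component.connected G"
  proof
    assume sub: "sccs_verts \<subseteq> ?T"
    obtain i where i: "i \<in> verts G" "c i = peak c (verts G)"
      using peak_attained[of "verts G" c] verts_nonempty finite_verts by blast
    obtain C where C: "C \<in> sccs_verts" "i \<in> C" using scc_exists i by blast
    then have "conn C" using conn_scc by blast
    moreover have "\<not> conn (verts G)" using nc connected_iff_conn by simp
    ultimately have "C \<subset> verts G" by (metis conn_def psubsetI)
    moreover have "C \<in> ?T" using sub C by blast
    ultimately have "peak c C < peak c (verts G)" "tube G C"
      using tube_verts unfolding dom_height_marking by blast+
    then show False using peak_ge[of C i c] C i finite_tube by fastforce
  qed
  ultimately have tub: "tubing G ?T"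
    unfolding tubing_def universal_tube_def pairwise_def using dom_height_marking by auto
  have "height_marking G c u = Some Thin"
    if uv: "u \<in> ?T" "v \<in> ?T" "u \<subset> v" "height_marking G c v \<noteq> Some Thick" for u v
  proof -
    have "peak c u < peak c v" using uv unfolding dom_height_marking by blast
    then show ?thesis using uv height_marking_Some[of u c] height_marking_Some[of v c]
      by (auto simp: sign_marking_def split: if_splits)
  qed
  then show ?thesis using tub unfolding marked_tubing_def by blast
qed

lemma marked_tubingD:
  assumes "marked_tubing G M"
  shows "tubing G (dom M)"
    "u \<in> dom M \<Longrightarrow> v \<in> dom M \<Longrightarrow> u \<subset> v \<Longrightarrow> M v \<noteq> Some Thick \<Longrightarrow> M u = Some Thin"
  using assms by (auto simp: marked_tubing_def)

text \<open>Tubes of \<open>M\<close> get values \<open>r\<close> that increase strictly along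
  inclusion and have the sign of the marking; each node gets the value of the smallest tube around
  it.\<close>

lemma height_marking_surj:
  assumes M: "marked_tubing G M"
  shows "\<exists>c. height_marking G c = M"
proof -
  let ?T = "dom M"
  \<comment> \<open>\<open>N\<close> exceeds the size of every tube, so subtracting it makes the
    values of thin tubes negative without changing their order.\<close>
  define N where "N = real (card (verts G)) + 1"
  define r where "r v = (case M v of Some Thick \<Rightarrow> real (card v) | Some Thin \<Rightarrow> real (card v) - N | _ \<Rightarrow> 0)" for v
  define c where "c i = r (tube_hull ?T {i})" for i
  have T: "tubing G ?T" using M marked_tubingD by blast
  have cards: "0 < card v" "real (card v) < N" if "v \<in> ?T" for v
  proof -
    have "tube G v" using that T tubingD by blast
    then have "card v \<le> card (verts G)" "card v \<noteq> 0"
      using card_mono[OF finite_verts tube_subset] tube_nonempty finite_tube by auto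
    then show "0 < card v" "real (card v) < N" by (auto simp: N_def)
  qed
  have sgn: "M v = Some (sign_marking (r v))" if v: "v \<in> ?T" for v
  proof -
    obtain m where "M v = Some m" using v by blast
    then show ?thesis using cards[OF v] by (cases m) (auto simp: r_def sign_marking_def)
  qed
  have r_less: "r x < r y" if xy: "x \<in> ?T" "y \<in> ?T" "x \<subset> y" for x y
  proof -
    obtain a b where ab: "M x = Some a" "M y = Some b" using xy by blast
    \<comment> \<open>Nested tubes are never both broken, so no tie at 0 occurs; nested tubes with
      equal marking are separated by their sizes.\<close>
    have "b = Thick \<or> a = Thin" using marked_tubingD(2)[OF M, of x y] xy ab by auto
    moreover have "card x < card y"
      using xy T tubingD(1) finite_tube psubset_card_mono by meson
    ultimately show ?thesis using cards[OF xy(1)] cards[OF xy(2)] ab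
      by (cases a; cases b) (auto simp: r_def)
  qed
  have r_le: "r x \<le> r y" if "x \<in> ?T" "y \<in> ?T" "x \<subseteq> y" for x y
    using r_less[of x y] that by (metis order.order_iff_strict psubsetI)
  note hull = tube_hull_mem_tube[OF T]
  \<comment> \<open>Monotonicity of \<open>r\<close> bounds all nodes of \<open>u\<close>, and
    \<open>tube_hull_attained\<close> provides a node of \<open>u\<close> with the same hull as
    \<open>u\<close>.\<close>
  have pk: "peak c u = r (tube_hull ?T u)" if u: "tube G u" for u
  proof -
    have "c j \<le> r (tube_hull ?T u)" if "j \<in> u" for j
    proof -
      have "tube G {j}" using that u tube_subset tube_singleton by blast
      then show ?thesis unfolding c_def
        using that u by (intro r_le hull tube_hull_mono) auto
    qed
    moreover obtain i where "i \<in> u" "c i = r (tube_hull ?T u)"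
      using tube_hull_attained[OF T u] by (auto simp: c_def)
    ultimately show ?thesis unfolding peak_def
      using finite_tube[OF u] by (intro Max_eqI) (auto simp: image_iff intro!: bexI[of _ i])
  qed
  have mem: "u \<in> ?T \<longleftrightarrow> u \<in> dom (height_marking G c)" for u
  proof
    assume u: "u \<in> ?T"
    have "peak c u < peak c v" if v: "tube G v" "u \<subset> v" for v
    proof -
      have "r u < r (tube_hull ?T v)"
        using u v hull tube_hull_superset[of v ?T] by (intro r_less) auto
      then show ?thesis using pk u v T tubingD(1) tube_hull_self by metis
    qed
    then show "u \<in> dom (height_marking G c)"
      unfolding dom_height_marking using u T tubingD(1) by blast
  next
    assume u: "u \<in> dom (height_marking G c)"
    then have t: "tube G u" unfolding dom_height_marking by blast
    show "u \<in> ?T"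
    proof (rule ccontr)
      assume "u \<notin> ?T"
      then have "u \<subset> tube_hull ?T u" using hull[OF t] tube_hull_superset[of u ?T] by auto
      moreover have th: "tube G (tube_hull ?T u)" using hull[OF t] T tubingD(1) by blast
      ultimately have "peak c u < peak c (tube_hull ?T u)"
        using u unfolding dom_height_marking by blast
      then show False using pk[OF t] pk[OF th] tube_hull_self[OF hull[OF t]] by simp
    qed
  qed
  have "height_marking G c u = M u" for u
  proof (cases "u \<in> ?T")
    case True
    then have "peak c u = r u" using pk tube_hull_self T tubingD(1) by metis
    then show ?thesis using True mem sgn height_marking_Some by metis
  next
    case False
    then show ?thesis using mem by (metis domIff)
  qed
  then show ?thesis by blast
qed

section \<open>Comparing the faces selected by two functionals\<close>

text \<open>For every tube, the nodes and the sign of the maximal coefficient determine the face that a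
  linear functional selects in the corresponding Minkowski summand; \<open>type_le\<close> says that the faces
  selected by \<open>c\<close> lie in those selected by \<open>c'\<close>.\<close>

definition type_le :: "('a \<Rightarrow> real) \<Rightarrow> ('a \<Rightarrow> real) \<Rightarrow> bool" where
  "type_le c c' \<longleftrightarrow> (\<forall>u. tube G u \<longrightarrow>
     (\<forall>i\<in>u. c i = peak c u \<longrightarrow> c' i = peak c' u) \<and>
     (sign_marking (peak c' u) = sign_marking (peak c u) \<or> sign_marking (peak c' u) = Broken))"

text \<open>A maximal tube around \<open>u\<close> with the same peak satisfies the growth
  condition, so it belongs to the tubing. The hull is squeezed between \<open>u\<close> and this
  tube.\<close>

lemma height_hull_peak:
  assumes "tube G u"
  shows "peak c (tube_hull (dom (height_marking G c)) u) = peak c u"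
proof -
  let ?T = "dom (height_marking G c)"
  let ?A = "{v. tube G v \<and> u \<subseteq> v \<and> peak c v = peak c u}"
  have fin: "finite ?A" using finite_subset[OF _ finite_tubes, of ?A] by blast
  have mem: "u \<in> ?A" using assms by blast
  obtain v where v: "v \<in> ?A" "\<forall>y\<in>?A. v \<subseteq> y \<longrightarrow> v = y"
    using finite_maximal_set[OF fin mem] by (elim bexE) blast
  have "peak c v < peak c y" if y: "tube G y" "v \<subset> y" for y
  proof -
    have "peak c v \<le> peak c y" using y v tube_nonempty by (intro peak_mono) auto
    moreover have "peak c y \<noteq> peak c u" using v y by blast
    ultimately show ?thesis using v by auto
  qed
  then have "v \<in> ?T" using v by (simp add: dom_height_marking)
  then have sub: "tube_hull ?T u \<subseteq> v" by (rule tube_hull_least) (use v in simp)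
  have T: "tubing G ?T" by (rule marked_tubingD(1)[OF marked_tubing_height_marking])
  have hT: "tube G (tube_hull ?T u)"
    by (rule tubingD(1)[OF T tube_hull_mem_tube[OF T assms]])
  have "peak c (tube_hull ?T u) \<le> peak c v"
    using sub v tube_nonempty[OF hT] by (intro peak_mono) auto
  moreover have "peak c u \<le> peak c (tube_hull ?T u)"
    by (rule peak_mono[OF hT tube_hull_superset tube_nonempty[OF assms]])
  ultimately show ?thesis using v by simp
qed

text \<open>By \<open>height_hull_peak\<close> the marking of a hull is the sign of the peak over
  the tube itself, so hulls disappear from the condition on the markings.\<close>

lemma refines_height_marking_iff:
  "marking_refines (height_marking G c) (height_marking G c') \<longleftrightarrow>
    dom (height_marking G c') \<subseteq> dom (height_marking G c) \<and>
    (\<forall>u\<in>dom (height_marking G c). sign_marking (peak c' u) = sign_marking (peak c u) \<or>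
       sign_marking (peak c' u) = Broken)"
proof -
  let ?M = "height_marking G c" and ?M' = "height_marking G c'"
  have T: "tubing G (dom ?M')" using marked_tubing_height_marking marked_tubingD by blast
  have "?M' (tube_hull (dom ?M') u) = Some (sign_marking (peak c' u))" if "u \<in> dom ?M" for u
  proof -
    have t: "tube G u" using that by (simp add: dom_height_marking)
    then have "tube_hull (dom ?M') u \<in> dom ?M'" by (rule tube_hull_mem_tube[OF T])
    then show ?thesis using height_hull_peak[OF t, of c'] height_marking_Some by metis
  qed
  then show ?thesis unfolding marking_refines_def
    using height_marking_Some[of _ c] by auto
qed

text \<open>If a tube of \<open>c'\<close> were not one of \<open>c\<close>, a larger tube would
  have the same peak for \<open>c\<close>, attained in the smaller one; \<open>c'\<close> would be
  maximal at that node too, against its growth condition. Conversely, the hulls with respect to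
  \<open>c\<close> and \<open>c'\<close> carry the data for an arbitrary tube.\<close>

lemma type_le_iff_refines: "type_le c c' \<longleftrightarrow> marking_refines (height_marking G c) (height_marking G c')"
proof
  let ?T = "dom (height_marking G c)" and ?T' = "dom (height_marking G c')"
  assume L: "type_le c c'"
  have "u \<in> ?T" if u: "u \<in> ?T'" for u
  proof -
    have t: "tube G u" using u by (simp add: dom_height_marking)
    have "peak c u < peak c v" if v: "tube G v" "u \<subset> v" for v
    proof (rule ccontr)
      assume "\<not> ?thesis"
      moreover obtain i where i: "i \<in> u" "c i = peak c u"
        using peak_attained finite_tube[OF t] tube_nonempty[OF t] by blast
      moreover have "peak c u \<le> peak c v" using v tube_nonempty[OF t] by (intro peak_mono) auto
      ultimately have "c i = peak c v" by simp
      then have "c' i = peak c' v" using L v i unfolding type_le_def by blast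
      moreover have "c' i \<le> peak c' u" by (rule peak_ge[OF finite_tube[OF t] i(1)])
      moreover have "peak c' u < peak c' v" using u v unfolding dom_height_marking by blast
      ultimately show False by simp
    qed
    then show ?thesis using t unfolding dom_height_marking by blast
  qed
  then show "marking_refines (height_marking G c) (height_marking G c')"
    unfolding refines_height_marking_iff
  proof (intro conjI subsetI ballI)
    fix u assume "u \<in> ?T"
    then have "tube G u" unfolding dom_height_marking by (rule conjunct1)
    then show "sign_marking (peak c' u) = sign_marking (peak c u) \<or>
        sign_marking (peak c' u) = Broken"
      using L unfolding type_le_def by meson
  qed
next
  let ?T = "dom (height_marking G c)" and ?T' = "dom (height_marking G c')"
  assume R: "marking_refines (height_marking G c) (height_marking G c')"
  note R' = R[unfolded refines_height_marking_iff]
  note sub = conjunct1[OF R'] and sg = bspec[OF conjunct2[OF R']]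
  have T: "tubing G ?T" and T': "tubing G ?T'"
    by (rule marked_tubingD(1)[OF marked_tubing_height_marking])+
  have "(\<forall>i\<in>u. c i = peak c u \<longrightarrow> c' i = peak c' u) \<and>
     (sign_marking (peak c' u) = sign_marking (peak c u) \<or> sign_marking (peak c' u) = Broken)"
    if t: "tube G u" for u
  proof -
    let ?v = "tube_hull ?T u" and ?v' = "tube_hull ?T' u"
    have v: "?v \<in> ?T" "u \<subseteq> ?v" "peak c ?v = peak c u"
      by (rule tube_hull_mem_tube[OF T t] tube_hull_superset height_hull_peak[OF t])+
    have v': "?v' \<in> ?T'" "u \<subseteq> ?v'" "peak c' ?v' = peak c' u"
      by (rule tube_hull_mem_tube[OF T' t] tube_hull_superset height_hull_peak[OF t])+
    have tv: "tube G ?v" "tube G ?v'" using v v' T T' tubingD(1) by blast+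
    \<comment> \<open>The peaks of \<open>c'\<close> on \<open>u\<close> and on the coarser hull
      \<open>?v'\<close> agree, and \<open>?v\<close> lies between them.\<close>
    have "?v \<subseteq> ?v'" using v' sub tube_hull_least by blast
    then have "peak c' ?v \<le> peak c' ?v'"
      using tv tube_nonempty by (intro peak_mono) auto
    moreover have "peak c' u \<le> peak c' ?v"
      using tv v tube_nonempty[OF t] by (intro peak_mono) auto
    ultimately have "peak c' ?v = peak c' u" using v' by simp
    then have "sign_marking (peak c' u) = sign_marking (peak c u) \<or> sign_marking (peak c' u) = Broken"
      using sg[OF v(1)] v by simp
    moreover have "c' i = peak c' u" if i: "i \<in> u" "c i = peak c u" for i
    proof (rule ccontr)
      assume "c' i \<noteq> peak c' u"
      then have less: "c' i < peak c' u" using i finite_tube[OF t] peak_ge[of u i c'] by simp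
      have ti: "tube G {i}" using i t tube_subset tube_singleton by blast
      \<comment> \<open>This tube omits a node of \<open>u\<close> but belongs to the finer tubing
        as well. It is therefore properly inside \<open>?v\<close>, where strict growth contradicts
        the maximality of \<open>c i\<close>.\<close>
      let ?x = "tube_hull ?T' {i}"
      have x: "?x \<in> ?T'" "i \<in> ?x" "peak c' ?x = c' i"
        using tube_hull_mem_tube[OF T' ti] tube_hull_superset[of "{i}" ?T']
          height_hull_peak[OF ti, of c'] by (simp_all add: peak_def)
      have tx: "tube G ?x" using x T' tubingD(1) by blast
      have "\<not> u \<subseteq> ?x" using less x peak_mono[OF tx, of u c'] tube_nonempty[OF t] by auto
      then have "\<not> ?v \<subseteq> ?x" using v by blast
      moreover have "?x \<in> ?T" using x sub by blast
      ultimately have "?x \<subset> ?v" using tubingD(4)[OF T v(1), of ?x] v i x by blast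
      then have "peak c ?x < peak c ?v" using tv \<open>?x \<in> ?T\<close> unfolding dom_height_marking by blast
      then show False using v i peak_ge[OF finite_tube[OF tx] x(2), of c] by simp
    qed
    ultimately show ?thesis by blast
  qed
  then show "type_le c c'" by (simp add: type_le_def)
qed

section \<open>The order generated by the moves\<close>

text \<open>Hulls compose by \<open>tube_hull_hull\<close>, and a hull that is broken in
  \<open>M2\<close> has a broken hull in \<open>M3\<close>.\<close>

lemma refines_trans:
  assumes M: "marked_tubing G M1" "marked_tubing G M2" "marked_tubing G M3"
    and "marking_refines M1 M2" "marking_refines M2 M3"
  shows "marking_refines M1 M3"
proof -
  have T: "tubing G (dom M1)" "tubing G (dom M2)" "tubing G (dom M3)"
    using M marked_tubingD(1) by blast+
  have sub: "dom M3 \<subseteq> dom M2" "dom M2 \<subseteq> dom M1" using assms by (auto simp: marking_refines_def)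
  have "M3 (tube_hull (dom M3) u) = M1 u \<or> M3 (tube_hull (dom M3) u) = Some Broken"
    if u: "u \<in> dom M1" for u
  proof -
    let ?v = "tube_hull (dom M2) u"
    have t: "tube G u" using u T tubingD(1) by blast
    have "?v \<in> dom M2" by (rule tube_hull_mem_tube[OF T(2) t])
    then have "M3 (tube_hull (dom M3) ?v) = M2 ?v \<or> M3 (tube_hull (dom M3) ?v) = Some Broken"
      using assms by (auto simp: marking_refines_def)
    moreover have "M2 ?v = M1 u \<or> M2 ?v = Some Broken" using u assms by (auto simp: marking_refines_def)
    moreover have "tube_hull (dom M3) ?v = tube_hull (dom M3) u"
      using tube_hull_hull T sub t by blast
    ultimately show ?thesis by metis
  qed
  then show ?thesis using sub by (auto simp: marking_refines_def)
qed

lemma hull_of_missing: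
  assumes "tubing G T" "tube G u" "u \<notin> T"
  shows "tube_hull T u \<in> T" "u \<subset> tube_hull T u"
proof -
  show "tube_hull T u \<in> T" by (rule tube_hull_mem_tube[OF assms(1,2)])
  then show "u \<subset> tube_hull T u" using assms(3) tube_hull_superset[of u T] by auto
qed

lemma marked_tubing_below:
  assumes "marked_tubing G M" "M v = Some m" "m \<noteq> Thick" "u \<subset> v" "u \<in> dom M"
  shows "M u = Some Thin"
  using marked_tubingD(2)[OF assms(1,5) _ assms(4)] assms(2,3) by auto

lemma marked_tubing_above:
  assumes "marked_tubing G M" "M u = Some m" "m \<noteq> Thin" "u \<subset> v" "v \<in> dom M"
  shows "M v = Some Thick"
  using marked_tubingD(2)[OF assms(1) _ assms(5,4)] assms(2,3) by auto

section \<open>From moves to refinements\<close>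

lemma marking_move_marked: "marking_move G M M' \<Longrightarrow> marked_tubing G M \<and> marked_tubing G M'"
  by (induction rule: marking_move.induct) (intro conjI; assumption)+

text \<open>Old tubes are their own hulls, so for the added tubes only the marking of the hull in
  \<open>M\<close> has to be determined.\<close>

lemma marking_move_refines:
  assumes "marking_move G M M'"
  shows "marking_refines M' M"
  using assms
proof cases
  case (resolve_broken u c)
  have "dom M' = dom M" using resolve_broken(2,4) by auto
  then show ?thesis using resolve_broken(2,4) by (simp add: marking_refines_def tube_hull_self)
next
  case (add_thin b v)
  have T: "tubing G (dom M)" by (rule marked_tubingD(1)[OF add_thin(1)])
  have dom: "dom M' = insert b (dom M)" using add_thin(5) by simp
  then have "tube G b" using tubingD(1)[OF marked_tubingD(1)[OF add_thin(6)]] by blast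
  note h = hull_of_missing[OF T this add_thin(2)]
  have v: "v \<in> dom M" using add_thin(4) by blast
  have sub: "tube_hull (dom M) b \<subseteq> v" using add_thin(3) by (intro tube_hull_least v) simp
  have "M (tube_hull (dom M) b) = Some Thin \<or> M (tube_hull (dom M) b) = Some Broken"
  proof (cases "tube_hull (dom M) b = v")
    case False
    then have "tube_hull (dom M) b \<subset> v" using sub by (rule psubsetI[rotated])
    then have "M (tube_hull (dom M) b) = Some Thin"
      using add_thin(4) marked_tubing_below[OF add_thin(1)] h(1) by blast
    then show ?thesis ..
  qed (use add_thin(4) in simp)
  then show ?thesis
    using add_thin(2,5) dom by (simp add: marking_refines_def tube_hull_self subset_insertI)
next
  case (add_thick b v)
  have T: "tubing G (dom M)" by (rule marked_tubingD(1)[OF add_thick(1)])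
  have dom: "dom M' = insert b (dom M)" using add_thick(5) by simp
  then have "tube G b" using tubingD(1)[OF marked_tubingD(1)[OF add_thick(6)]] by blast
  note h = hull_of_missing[OF T this add_thick(2)]
  \<comment> \<open>A thick tube has only thick tubes above it, and its hull keeps the marking it
    had in \<open>M\<close>.\<close>
  have "M' b = Some Thick" using add_thick(5) by simp
  then have "M' (tube_hull (dom M) b) = Some Thick"
    by (rule marked_tubing_above[OF add_thick(6) _ _ h(2)]) (use h(1) dom in simp_all)
  moreover have "tube_hull (dom M) b \<noteq> b" using h by blast
  ultimately have "M (tube_hull (dom M) b) = Some Thick" using add_thick(5) by simp
  then show ?thesis
    using add_thick(2,5) dom by (simp add: marking_refines_def tube_hull_self subset_insertI)
next
  case (add_broken v B)
  have T: "tubing G (dom M)" by (rule marked_tubingD(1)[OF add_broken(1)])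
  have v: "v \<in> dom M" "v \<notin> B" using add_broken(2,4) by blast+
  have dom: "dom M' = dom M \<union> B"
    using v by (auto simp: add_broken(6) split: if_splits)
  \<comment> \<open>Close nesting excludes an old tube strictly between \<open>u\<close> and
    \<open>v\<close>.\<close>
  have "tube_hull (dom M) u = v" if u: "u \<in> B" for u
  proof -
    have "tube G u" using dom u tubingD(1)[OF marked_tubingD(1)[OF add_broken(8)]] by blast
    moreover have "u \<notin> dom M" using add_broken(4) u by blast
    ultimately have h: "tube_hull (dom M) u \<in> dom M" "u \<subset> tube_hull (dom M) u"
      by (rule hull_of_missing[OF T])+
    have cn: "closely_nested (dom M') u v" using add_broken(7) u by blast
    then have "u \<subseteq> v" by (auto simp: closely_nested_def)
    then have "tube_hull (dom M) u \<subseteq> v" by (rule tube_hull_least[OF v(1)])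
    moreover have "\<not> tube_hull (dom M) u \<subset> v"
      using cn h(2) UnI1[OF h(1), of B] unfolding closely_nested_def dom by meson
    ultimately show ?thesis by blast
  qed
  then have "M (tube_hull (dom M) u) = M' u \<or> M (tube_hull (dom M) u) = Some Broken"
    if "u \<in> dom M'" for u
    using that dom add_broken(2) tube_hull_self[of u "dom M"] by (cases "u \<in> B") (auto simp: add_broken(6))
  then show ?thesis using dom by (simp add: marking_refines_def)
qed

section \<open>From refinements back to moves\<close>

text \<open>Every move from \<open>M\<close> towards its refinement \<open>M'\<close> has the form \<open>override_on M M' S\<close>.\<close>

lemma override_on_marked_refines:
  assumes M: "marked_tubing G M" and M': "marked_tubing G M'" and ref: "marking_refines M' M"
    and S: "S \<subseteq> dom M'"
    and hull: "\<And>k u. k \<in> S \<Longrightarrow> u \<in> dom M' \<Longrightarrow> tube_hull (dom M \<union> S) u = k \<Longrightarrow>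
      M' k = M' u \<or> M' k = Some Broken"
    and lower: "\<And>x y. x \<in> S \<Longrightarrow> y \<in> dom M - S \<Longrightarrow> x \<subset> y \<Longrightarrow> M y = Some Broken \<Longrightarrow>
      M' x = Some Thin"
    and upper: "\<And>x y. y \<in> S \<Longrightarrow> x \<in> dom M - S \<Longrightarrow> x \<subset> y \<Longrightarrow> M' y \<noteq> Some Thick \<Longrightarrow>
      M x \<noteq> Some Broken"
  shows "marked_tubing G (override_on M M' S) \<and> marking_refines M' (override_on M M' S)"
proof
  let ?M = "override_on M M' S"
  have dom: "dom ?M = dom M \<union> S" using S by (auto simp: override_on_def split: if_splits)
  have T: "tubing G (dom M)" and T': "tubing G (dom M')" using M M' marked_tubingD(1) by blast+
  have sub: "dom M \<subseteq> dom M'" using ref by (auto simp: marking_refines_def)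
  have val: "M x = M' x \<or> M x = Some Broken" if "x \<in> dom M" for x
    using ref that sub unfolding marking_refines_def by (metis subsetD tube_hull_self)
  have T1: "tubing G (dom ?M)"
    using tubing_subset[OF T', of "dom ?M"] dom S sub tubingD(2)[OF T] by blast
  have "?M x = Some Thin" if xy: "x \<in> dom ?M" "y \<in> dom ?M" "x \<subset> y" "?M y \<noteq> Some Thick" for x y
  proof -
    have xy': "x \<in> dom M'" "y \<in> dom M'" using xy dom S sub by blast+
    consider "x \<in> S" "y \<in> S" | "x \<in> S" "y \<in> dom M - S" | "x \<in> dom M - S" "y \<in> S"
      | "x \<in> dom M - S" "y \<in> dom M - S" using xy dom by blast
    then show ?thesis
    proof cases
      case 1
      then show ?thesis using xy(4) marked_tubingD(2)[OF M' xy' xy(3)] by simp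
    next
      case 2
      then have "M' x = Some Thin"
        using xy(4) marked_tubingD(2)[OF M' xy' xy(3)] val[of y] lower[OF 2 xy(3)] by force
      then show ?thesis using 2 by simp
    next
      case 3
      then have "M' x = Some Thin" "M x \<noteq> Some Broken"
        using xy(4) marked_tubingD(2)[OF M' xy' xy(3)] upper[OF 3(2,1) xy(3)] by auto
      then show ?thesis using 3 val[of x] by simp
    next
      case 4
      then show ?thesis using xy(4) marked_tubingD(2)[OF M _ _ xy(3)] by simp
    qed
  qed
  then show "marked_tubing G ?M" using T1 unfolding marked_tubing_def by blast
  have "?M (tube_hull (dom ?M) u) = M' u \<or> ?M (tube_hull (dom ?M) u) = Some Broken"
    if u: "u \<in> dom M'" for u
  proof (cases "tube_hull (dom ?M) u \<in> S")
    case True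
    then show ?thesis using hull[OF True u] dom by simp
  next
    case False
    have t: "tube G u" using u T' tubingD(1) by blast
    \<comment> \<open>A hull outside \<open>S\<close> is an old tube, so it coincides with the hull
      in \<open>M\<close>.\<close>
    have "tube_hull (dom ?M) u \<in> dom M"
      using False dom tube_hull_mem_tube[OF T1 t] by blast
    then have "tube_hull (dom M) (tube_hull (dom ?M) u) = tube_hull (dom ?M) u"
      by (rule tube_hull_self)
    moreover have "tube_hull (dom M) (tube_hull (dom ?M) u) = tube_hull (dom M) u"
      by (rule tube_hull_hull[OF T _ t]) (unfold dom, rule Un_upper1)
    ultimately have "tube_hull (dom ?M) u = tube_hull (dom M) u" by simp
    then show ?thesis using False ref u by (simp add: marking_refines_def)
  qed
  then show "marking_refines M' ?M" using dom S sub by (auto simp: marking_refines_def)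
qed

text \<open>Missing tubes are treated in a fixed order: a thin one, one with a thick hull, all
  broken ones with a common broken hull. When only thick tubes with broken hulls are missing, or
  none at all, some old broken tube is marked differently in \<open>M'\<close> and can be resolved.
  Each move removes at least one disagreement and creates none.\<close>

lemma refines_step:
  assumes M: "marked_tubing G M" and M': "marked_tubing G M'" and ref: "marking_refines M' M"
    and ne: "M \<noteq> M'"
  shows "\<exists>M1. marking_move G M M1 \<and> marked_tubing G M1 \<and> marking_refines M' M1 \<and>
    {u. M1 u \<noteq> M' u} \<subset> {u. M u \<noteq> M' u}"
proof -
  let ?T = "dom M" and ?T' = "dom M'" and ?h = "tube_hull (dom M)"
  have T: "tubing G ?T" and T': "tubing G ?T'" using M M' marked_tubingD(1) by blast+
  have sub: "?T \<subseteq> ?T'" using ref by (auto simp: marking_refines_def)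
  have val: "M (?h u) = M' u \<or> M (?h u) = Some Broken" if "u \<in> ?T'" for u
    using ref that by (auto simp: marking_refines_def)
  have hb: "?h b \<in> ?T" "b \<subset> ?h b" if "b \<in> ?T' - ?T" for b
    using that hull_of_missing[OF T] T' tubingD(1) by blast+
  have *: ?thesis if "marking_move G M (override_on M M' S)" "marking_refines M' (override_on M M' S)"
    "s \<in> S" "M s \<noteq> M' s" for S s
  proof -
    have "{u. override_on M M' S u \<noteq> M' u} \<subset> {u. M u \<noteq> M' u}"
      using that(3,4) by (auto simp: override_on_def)
    then show ?thesis using that marking_move_marked by blast
  qed
  show ?thesis
  proof (cases "\<exists>b\<in>?T' - ?T. M' b = Some Thin")
    case True
    then obtain b where b: "b \<in> ?T' - ?T" "M' b = Some Thin" by blast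
    let ?N = "override_on M M' {b}"
    have hv: "M (?h b) = Some Thin \<or> M (?h b) = Some Broken" using val[of b] b by auto
    have N: "marked_tubing G ?N \<and> marking_refines M' ?N"
    proof (rule override_on_marked_refines[OF M M' ref])
      fix k u assume "k \<in> {b}" "u \<in> ?T'" "tube_hull (?T \<union> {b}) u = k"
      then have ub: "u \<subseteq> b" "k = b" using tube_hull_superset[of u "?T \<union> {b}"] by auto
      have "M' u = Some Thin"
      proof (cases "u = b")
        case False
        then show ?thesis
          by (intro marked_tubing_below[OF M' b(2) _ psubsetI[OF ub(1)] \<open>u \<in> ?T'\<close>]) auto
      qed (use b in simp)
      then show "M' k = M' u \<or> M' k = Some Broken" using ub b by simp
    next
      fix x y assume "y \<in> {b}" "x \<in> ?T - {b}" "x \<subset> y"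
      then have "x \<subset> ?h b" "x \<in> ?T" using hb[OF b(1)] by blast+
      then have "M x = Some Thin" using hv marked_tubing_below[OF M, of "?h b" _ x] by blast
      then show "M x \<noteq> Some Broken" by simp
    qed (use b in auto)
    have N_eq: "?N = M(b \<mapsto> Thin)" using b by (auto simp: override_on_def)
    have "marking_move G M ?N"
      by (rule marking_move.add_thin[OF M _ hb(2)[OF b(1)] hv N_eq conjunct1[OF N]]) (use b in simp)
    then show ?thesis by (rule *[OF _ conjunct2[OF N], of b]) (use b in auto)
  next
    case noThin: False
    show ?thesis
    proof (cases "\<exists>b\<in>?T' - ?T. M (?h b) = Some Thick")
      case True
      then obtain b where b: "b \<in> ?T' - ?T" "M (?h b) = Some Thick" by blast
      then have bt: "M' b = Some Thick" using val[of b] by auto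
      let ?N = "override_on M M' {b}"
      have N: "marked_tubing G ?N \<and> marking_refines M' ?N"
      proof (rule override_on_marked_refines[OF M M' ref])
        fix k u assume ku: "k \<in> {b}" "u \<in> ?T'" "tube_hull (?T \<union> {b}) u = k"
        have "?h u = ?h b"
          using tube_hull_hull[OF T Un_upper1 tubingD(1)[OF T' ku(2)], of "{b}"] ku by simp
        then show "M' k = M' u \<or> M' k = Some Broken" using val[of u] ku b bt by auto
      next
        fix x y assume xy: "x \<in> {b}" "y \<in> ?T - {b}" "x \<subset> y" "M y = Some Broken"
        then have "?h b \<subseteq> y" by (intro tube_hull_least) auto
        moreover have "?h b \<noteq> y" using xy(4) b(2) by auto
        ultimately have "?h b \<subset> y" by blast
        then have "M (?h b) = Some Thin"
          by (intro marked_tubing_below[OF M xy(4)] hb(1) b(1)) auto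
        then show "M' x = Some Thin" using b(2) by simp
      qed (use b bt in auto)
      have N_eq: "?N = M(b \<mapsto> Thick)" using bt by (auto simp: override_on_def)
      have "marking_move G M ?N"
        by (rule marking_move.add_thick[OF M _ hb(2)[OF b(1)] b(2) N_eq conjunct1[OF N]])
          (use b in simp)
      then show ?thesis by (rule *[OF _ conjunct2[OF N], of b]) (use b bt in auto)
    next
      case noThick: False
      \<comment> \<open>A thin hull would force the missing tube to be thin, so with the first two
        cases excluded only broken hulls remain.\<close>
      have extra: "M (?h b) = Some Broken" if b: "b \<in> ?T' - ?T" for b
      proof -
        have "M' b \<noteq> Some Thin" "M (?h b) \<noteq> Some Thick" using b noThin noThick by blast+
        moreover obtain m where "M (?h b) = Some m" using hb[OF b] by blast
        ultimately show ?thesis using val[of b] b by (cases m) auto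
      qed
      show ?thesis
      proof (cases "\<exists>b\<in>?T' - ?T. M' b = Some Broken")
        case True
        then obtain b where b: "b \<in> ?T' - ?T" "M' b = Some Broken" by blast
        define v where "v = ?h b"
        \<comment> \<open>These tubes must come together: once \<open>v\<close> is thick, a broken
          tube of \<open>M'\<close> with hull \<open>v\<close> that is still missing would violate
          refinement.\<close>
        define B where "B = {x \<in> ?T' - ?T. ?h x = v \<and> M' x = Some Broken}"
        have v: "v \<in> ?T" "b \<subset> v" "M v = Some Broken"
          unfolding v_def by (rule hb extra, rule b)+
        have M'v: "M' v = Some Thick"
          by (rule marked_tubing_above[OF M' b(2) _ v(2)]) (use v sub in auto)
        have bB: "b \<in> B" using b by (simp add: B_def v_def)
        have Bv: "x \<subset> v" if "x \<in> B" for x using that hb[of x] by (auto simp: B_def)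
        let ?S = "insert v B"
        let ?N = "override_on M M' ?S"
        have below: "M x = Some Thin" if "x \<in> ?T" "x \<subset> v" for x
          by (rule marked_tubing_below[OF M v(3) _ that(2,1)]) simp
        have above: "M y \<noteq> Some Broken" if "y \<in> ?T" "v \<subset> y" for y
          using marked_tubing_above[OF M v(3) _ that(2,1)] by simp
        have N: "marked_tubing G ?N \<and> marking_refines M' ?N"
        proof (rule override_on_marked_refines[OF M M' ref])
          fix k u assume ku: "k \<in> ?S" "u \<in> ?T'" "tube_hull (?T \<union> ?S) u = k"
          show "M' k = M' u \<or> M' k = Some Broken"
          proof (cases "k \<in> B")
            case True
            then show ?thesis by (simp add: B_def)
          next
            case False
            then have k: "k = v" using ku by blast
            have hu: "?h u = v"
              using tube_hull_hull[OF T Un_upper1 tubingD(1)[OF T' ku(2)], of ?S] ku k v tube_hull_self[of v ?T]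
              by simp
            show ?thesis
            proof (cases "u \<in> ?T")
              case True
              then show ?thesis using hu k tube_hull_self[of u ?T] by auto
            next
              case uT: False
              \<comment> \<open>A tube of \<open>B\<close> would be its own hull. What remains
                inside \<open>v\<close> is neither broken nor thin, hence thick like
                \<open>v\<close> in \<open>M'\<close>.\<close>
              have "u \<notin> B" using k ku v uT tube_hull_self[of u "?T \<union> ?S"] by auto
              then have "M' u \<noteq> Some Broken" using uT ku hu by (auto simp: B_def)
              moreover have "M' u \<noteq> Some Thin" using noThin uT ku by blast
              moreover obtain m where "M' u = Some m" using ku by blast
              ultimately have "M' u = Some Thick" by (cases m) auto
              then show ?thesis using k M'v by simp
            qed
          qed
        next
          fix x y assume xy: "x \<in> ?S" "y \<in> ?T - ?S" "x \<subset> y" "M y = Some Broken"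
          have "v \<subseteq> y"
          proof (cases "x = v")
            case False
            then have "?h x = v" using xy by (auto simp: B_def)
            then show ?thesis using tube_hull_least[of y ?T x] xy by auto
          qed (use xy in auto)
          then have "v \<subset> y" using xy by blast
          then show "M' x = Some Thin" using above[of y] xy by blast
        next
          fix x y assume xy: "y \<in> ?S" "x \<in> ?T - ?S" "x \<subset> y" "M' y \<noteq> Some Thick"
          then have "x \<subset> v" using Bv by blast
          then show "M x \<noteq> Some Broken" using below[of x] xy by auto
        qed (use v sub in \<open>auto simp: B_def\<close>)
        have N_eq: "?N = (\<lambda>w. if w \<in> B then Some Broken else if w = v then Some Thick else M w)"
          using M'v v by (auto simp: override_on_def B_def)
        have pw: "pairwise (compatible_tubes G) B"
          by (rule pairwise_subset[of _ ?T']) (use T' in \<open>auto simp: tubing_def B_def\<close>)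
        have cn: "closely_nested (dom ?N) u v" if u: "u \<in> B" for u
        proof -
          \<comment> \<open>Broken tubes are never nested, and an old tube around \<open>u\<close>
            contains its hull \<open>v\<close>.\<close>
          have "\<not> (u \<subset> x \<and> x \<subset> v)" if x: "x \<in> dom ?N" for x
          proof
            assume ux: "u \<subset> x \<and> x \<subset> v"
            have "x \<in> B \<or> x \<in> ?T" using x v sub by (auto simp: override_on_def split: if_splits)
            then show False
            proof
              assume "x \<in> B"
              then have "M' x = Some Broken" "M' u = Some Broken" "u \<in> ?T'"
                using u by (simp_all add: B_def)
              then show False using ux marked_tubing_below[OF M', of x Broken u] by simp
            next
              assume "x \<in> ?T"
              moreover have "?h u = v" using u by (simp add: B_def)
              ultimately have "v \<subseteq> x" using tube_hull_least[of x ?T u] ux by blast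
              then show False using ux by blast
            qed
          qed
          then show ?thesis using Bv[OF u] unfolding closely_nested_def by blast
        qed
        have "marking_move G M ?N"
          by (rule marking_move.add_broken[OF M v(3) _ _ pw N_eq _ conjunct1[OF N]])
            (use bB cn in \<open>auto simp: B_def\<close>)
        then show ?thesis by (rule *[OF _ conjunct2[OF N], of b]) (use b bB in auto)
      next
        case noBroken: False
        have thick: "M' b = Some Thick" if b: "b \<in> ?T' - ?T" for b
        proof -
          obtain m where "M' b = Some m" using b by blast
          then show ?thesis using noThin noBroken b by (cases m) auto
        qed
        \<comment> \<open>Otherwise some tube is missing, and its hull would be broken in
          \<open>M\<close> but thick in \<open>M'\<close>, as it lies above a thick tube.\<close>
        have "\<exists>u\<in>?T. M u \<noteq> M' u"
        proof (rule ccontr)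
          assume eq: "\<not> ?thesis"
          obtain b where "M b \<noteq> M' b" using ne by blast
          then have b: "b \<in> ?T' - ?T" using eq by (auto simp: domIff)
          have "M' (?h b) = Some Broken" using eq extra[OF b] hb(1)[OF b] by metis
          moreover have "M' (?h b) = Some Thick"
            by (rule marked_tubing_above[OF M' thick[OF b] _ hb(2)[OF b]]) (use hb(1)[OF b] sub in auto)
          ultimately show False by simp
        qed
        then obtain u where u: "u \<in> ?T" "M u \<noteq> M' u" by blast
        have Mu: "M u = Some Broken" using val[of u] u sub tube_hull_self[of u ?T] by auto
        let ?N = "override_on M M' {u}"
        have N: "marked_tubing G ?N \<and> marking_refines M' ?N"
        proof (rule override_on_marked_refines[OF M M' ref])
          fix k w assume kw: "k \<in> {u}" "w \<in> ?T'" "tube_hull (?T \<union> {u}) w = k"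
          have "?T \<union> {u} = ?T" using u by blast
          then have hw: "?h w = u" using kw by simp
          show "M' k = M' w \<or> M' k = Some Broken"
          proof (cases "w \<in> ?T")
            case True
            then show ?thesis using hw kw tube_hull_self[of w ?T] by auto
          next
            case False
            then have w: "w \<in> ?T' - ?T" using kw by blast
            have "M' u = Some Thick"
              by (rule marked_tubing_above[OF M' thick[OF w]]) (use hb(2)[OF w] hw sub u in auto)
            then show ?thesis using thick[OF w] kw by simp
          qed
        next
          fix x y assume "x \<in> {u}" "y \<in> ?T - {u}" "x \<subset> y" "M y = Some Broken"
          then show "M' x = Some Thin" using marked_tubing_above[OF M Mu, of y] by simp
        next
          fix x y assume "y \<in> {u}" "x \<in> ?T - {u}" "x \<subset> y"
          then show "M x \<noteq> Some Broken" using marked_tubing_below[OF M Mu, of x] by simp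
        qed (use u sub in auto)
        obtain m where m: "M' u = Some m" using u sub by blast
        have N_eq: "?N = M(u \<mapsto> m)" using m by (auto simp: override_on_def)
        have "m = Thin \<or> m = Thick" using m u Mu by (cases m) auto
        then have "marking_move G M ?N"
          by (rule marking_move.resolve_broken[OF M Mu _ N_eq conjunct1[OF N]])
        then show ?thesis by (rule *[OF _ conjunct2[OF N], of u]) (use u in auto)
      qed
    qed
  qed
qed

text \<open>Induction on the finite number of sets at which the two maps disagree.\<close>

lemma refines_imp_moves:
  assumes "marked_tubing G M" "marked_tubing G M'" "marking_refines M' M"
  shows "(marking_move G)\<^sup>*\<^sup>* M M'"
  using assms
proof (induction "card {u. M u \<noteq> M' u}" arbitrary: M rule: less_induct)
  case less
  show ?case
  proof (cases "M = M'")
    case False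
    then obtain M1 where M1: "marking_move G M M1" "marked_tubing G M1" "marking_refines M' M1"
      "{u. M1 u \<noteq> M' u} \<subset> {u. M u \<noteq> M' u}"
      using refines_step less by metis
    have "{u. M u \<noteq> M' u} \<subseteq> dom M \<union> dom M'" by (auto simp: domIff)
    then have "finite {u. M u \<noteq> M' u}"
      using less finite_tubing marked_tubingD(1) by (meson finite_UnI finite_subset)
    then have "card {u. M1 u \<noteq> M' u} < card {u. M u \<noteq> M' u}"
      using M1(4) by (rule psubset_card_mono)
    then have "(marking_move G)\<^sup>*\<^sup>* M1 M'" using less M1 by blast
    with M1(1) show ?thesis by (rule converse_rtranclp_into_rtranclp)
  qed auto
qed

lemma moves_imp_refines:
  assumes "(marking_move G)\<^sup>*\<^sup>* M M'" "marked_tubing G M"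
  shows "marked_tubing G M' \<and> marking_refines M' M"
  using assms
proof (induction rule: rtranclp_induct)
  case base
  then show ?case by (simp add: refines_refl)
next
  case (step N N')
  then show ?case using marking_move_marked marking_move_refines refines_trans by metis
qed

lemma marked_tubing_le_iff_refines:
  assumes "marked_tubing G M" "marked_tubing G M'"
  shows "marked_tubing_le G M' M \<longleftrightarrow> marking_refines M' M"
  unfolding marked_tubing_le_def using assms refines_imp_moves moves_imp_refines by blast

section \<open>The polytope\<close>

text \<open>The values \<open>w \<bullet> b i\<close> are prescribed only at the nodes
  \<open>i\<close> of the graph.\<close>

lemma height_marking_cong:
  assumes "\<And>i. i \<in> verts G \<Longrightarrow> c i = c' i"
  shows "height_marking G c = height_marking G c'"
proof -
  have "c ` u = c' ` u" if "tube G u" for u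
    by (rule image_cong) (use assms tube_subset[OF that] in auto)
  then have "peak c u = peak c' u" if "tube G u" for u
    using that by (simp add: peak_def)
  then show ?thesis unfolding height_marking_def by (intro ext) auto
qed

end

section \<open>Faces of a single Minkowski summand\<close>

definition dilated_simplex_vertices :: "('a \<Rightarrow> 'e::real_vector) \<Rightarrow> 'a set \<Rightarrow> 'e set" where
  "dilated_simplex_vertices b u = (\<lambda>(s, i). s *\<^sub>R b i) ` ({1, 2} \<times> u)"

text \<open>At a node with maximal value \<open>p\<close>, passing from factor 1 to factor 2 gains
  \<open>p\<close>. The sign of \<open>p\<close> thus selects the factor, and both are optimal when
  \<open>p\<close> is zero.\<close>

lemma mem_maximizers_dilated_simplex:
  fixes b :: "'a \<Rightarrow> 'e::euclidean_space" and w :: 'e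
  assumes u: "finite u" "i \<in> u" and s: "s = 1 \<or> s = 2"
  defines "p \<equiv> peak (\<lambda>i. w \<bullet> b i) u"
  shows "s *\<^sub>R b i \<in> maximizers w (dilated_simplex_vertices b u) \<longleftrightarrow>
    w \<bullet> b i = p \<and> (s = 1 \<longrightarrow> p \<le> 0) \<and> (s = 2 \<longrightarrow> 0 \<le> p)"
proof -
  have le: "w \<bullet> b k \<le> p" if "k \<in> u" for k
    unfolding p_def peak_def using u that by (intro Max_ge) auto
  have "p \<in> (\<lambda>i. w \<bullet> b i) ` u"
    unfolding p_def peak_def using u by (intro Max_in) auto
  then obtain j where j: "j \<in> u" "w \<bullet> b j = p" by blast
  have mem: "s *\<^sub>R b i \<in> dilated_simplex_vertices b u"
    using u s by (auto simp: dilated_simplex_vertices_def)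
  have eq: "s *\<^sub>R b i \<in> maximizers w (dilated_simplex_vertices b u) \<longleftrightarrow>
      (\<forall>k\<in>u. w \<bullet> b k \<le> s * (w \<bullet> b i) \<and> 2 * (w \<bullet> b k) \<le> s * (w \<bullet> b i))"
    using mem unfolding maximizers_def by (auto simp: dilated_simplex_vertices_def)
  show ?thesis unfolding eq
  proof
    assume "\<forall>k\<in>u. w \<bullet> b k \<le> s * (w \<bullet> b i) \<and> 2 * (w \<bullet> b k) \<le> s * (w \<bullet> b i)"
    then have "p \<le> s * (w \<bullet> b i)" "2 * p \<le> s * (w \<bullet> b i)" using j by auto
    then show "w \<bullet> b i = p \<and> (s = 1 \<longrightarrow> p \<le> 0) \<and> (s = 2 \<longrightarrow> 0 \<le> p)"
      using le[OF u(2)] s by auto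
  next
    assume R: "w \<bullet> b i = p \<and> (s = 1 \<longrightarrow> p \<le> 0) \<and> (s = 2 \<longrightarrow> 0 \<le> p)"
    show "\<forall>k\<in>u. w \<bullet> b k \<le> s * (w \<bullet> b i) \<and> 2 * (w \<bullet> b k) \<le> s * (w \<bullet> b i)"
    proof
      fix k assume "k \<in> u"
      from le[OF this] R s show "w \<bullet> b k \<le> s * (w \<bullet> b i) \<and> 2 * (w \<bullet> b k) \<le> s * (w \<bullet> b i)"
        by auto
    qed
  qed
qed

lemma maximizers_dilated_simplex_subset_iff:
  fixes b :: "'a \<Rightarrow> 'e::euclidean_space" and w w' :: 'e
  assumes u: "finite u" "u \<noteq> {}"
  defines "c \<equiv> \<lambda>w i. w \<bullet> b i"
  shows "maximizers w (dilated_simplex_vertices b u) \<subseteq> maximizers w' (dilated_simplex_vertices b u) \<longleftrightarrow>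
    (\<forall>i\<in>u. c w i = peak (c w) u \<longrightarrow> c w' i = peak (c w') u) \<and>
    (sign_marking (peak (c w') u) = sign_marking (peak (c w) u) \<or>
     sign_marking (peak (c w') u) = Broken)"
proof -
  let ?p = "peak (c w) u" and ?p' = "peak (c w') u"
  note mem = mem_maximizers_dilated_simplex[OF u(1), where b = b, folded c_def]
  have "?p \<in> c w ` u" unfolding peak_def using u by (intro Max_in) auto
  then obtain j where j: "j \<in> u" "c w j = ?p" by auto
  \<comment> \<open>Both sides say that every factor optimal for \<open>w\<close> is optimal for
    \<open>w'\<close>: factor 1 is optimal for nonpositive peaks, factor 2 for nonnegative
    ones.\<close>
  have sgn: "(sign_marking ?p' = sign_marking ?p \<or> sign_marking ?p' = Broken) \<longleftrightarrow>
      (?p \<le> 0 \<longrightarrow> ?p' \<le> 0) \<and> (0 \<le> ?p \<longrightarrow> 0 \<le> ?p')"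
    by (auto simp: sign_marking_def)
  show ?thesis unfolding sgn
  proof
    assume L: "maximizers w (dilated_simplex_vertices b u) \<subseteq> maximizers w' (dilated_simplex_vertices b u)"
    have 1: "c w' i = ?p' \<and> ?p' \<le> 0" if i: "i \<in> u" "c w i = ?p" "?p \<le> 0" for i
    proof -
      have "1 *\<^sub>R b i \<in> maximizers w' (dilated_simplex_vertices b u)"
        using mem[of i 1 w] i L by (auto simp: c_def)
      then show ?thesis using mem[of i 1 w'] i by (simp add: c_def)
    qed
    have 2: "c w' i = ?p' \<and> 0 \<le> ?p'" if i: "i \<in> u" "c w i = ?p" "0 \<le> ?p" for i
    proof -
      have "2 *\<^sub>R b i \<in> maximizers w' (dilated_simplex_vertices b u)"
        using mem[of i 2 w] i L by (auto simp: c_def)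
      then show ?thesis using mem[of i 2 w'] i by (simp add: c_def)
    qed
    show "(\<forall>i\<in>u. c w i = ?p \<longrightarrow> c w' i = ?p') \<and> (?p \<le> 0 \<longrightarrow> ?p' \<le> 0) \<and> (0 \<le> ?p \<longrightarrow> 0 \<le> ?p')"
      using 1 2 j by (meson linear)
  next
    assume R: "(\<forall>i\<in>u. c w i = ?p \<longrightarrow> c w' i = ?p') \<and> (?p \<le> 0 \<longrightarrow> ?p' \<le> 0) \<and> (0 \<le> ?p \<longrightarrow> 0 \<le> ?p')"
    show "maximizers w (dilated_simplex_vertices b u) \<subseteq> maximizers w' (dilated_simplex_vertices b u)"
    proof
      fix e assume e: "e \<in> maximizers w (dilated_simplex_vertices b u)"
      then obtain s i where si: "i \<in> u" "s = 1 \<or> s = 2" "e = s *\<^sub>R b i"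
        by (auto simp: maximizers_def dilated_simplex_vertices_def)
      then have "c w i = ?p \<and> (s = 1 \<longrightarrow> ?p \<le> 0) \<and> (s = 2 \<longrightarrow> 0 \<le> ?p)"
        using mem[of i s w] e by (simp add: c_def)
      then show "e \<in> maximizers w' (dilated_simplex_vertices b u)"
        using mem[of i s w'] R si by (simp add: c_def)
    qed
  qed
qed

definition graph_multiplihedron_vertices ::
  "('a, 'b) pre_digraph \<Rightarrow> ('a \<Rightarrow> 'e::euclidean_space) \<Rightarrow> 'e set" where
  "graph_multiplihedron_vertices G b = minkowski_sum {u. tube G u} (dilated_simplex_vertices b)"

section \<open>The graph multiplihedron and its face poset\<close>

context nonempty_graph begin

lemma finite_dilated_simplex_vertices: "tube G u \<Longrightarrow> finite (dilated_simplex_vertices b u)"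
  by (simp add: dilated_simplex_vertices_def finite_tube)

lemma dilated_simplex_vertices_nonempty: "tube G u \<Longrightarrow> dilated_simplex_vertices b u \<noteq> {}"
  by (simp add: dilated_simplex_vertices_def tube_nonempty)

lemma finite_graph_multiplihedron_vertices: "finite (graph_multiplihedron_vertices G b)"
  unfolding graph_multiplihedron_vertices_def
  by (rule finite_minkowski_sum[OF finite_tubes]) (simp add: finite_dilated_simplex_vertices)

lemma graph_multiplihedron_vertices_nonempty: "graph_multiplihedron_vertices G b \<noteq> {}"
  unfolding graph_multiplihedron_vertices_def
  by (rule minkowski_sum_nonempty) (simp add: dilated_simplex_vertices_nonempty)

lemma maximizers_graph_multiplihedron_subset_iff:
  "maximizers w (convex hull (graph_multiplihedron_vertices G b)) \<subseteq>
     maximizers w' (convex hull (graph_multiplihedron_vertices G b)) \<longleftrightarrow>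
   type_le (\<lambda>i. w \<bullet> b i) (\<lambda>i. w' \<bullet> b i)"
proof -
  let ?E = "dilated_simplex_vertices b"
  have "maximizers w (minkowski_sum {u. tube G u} ?E) \<subseteq> maximizers w' (minkowski_sum {u. tube G u} ?E) \<longleftrightarrow>
      (\<forall>u\<in>{u. tube G u}. maximizers w (?E u) \<subseteq> maximizers w' (?E u))"
    by (rule maximizers_minkowski_sum_subset_iff[OF finite_tubes])
      (simp_all add: finite_dilated_simplex_vertices dilated_simplex_vertices_nonempty)
  also have "\<dots> \<longleftrightarrow> type_le (\<lambda>i. w \<bullet> b i) (\<lambda>i. w' \<bullet> b i)"
    unfolding type_le_def
    by (simp add: maximizers_dilated_simplex_subset_iff finite_tube tube_nonempty)
  finally show ?thesis
    unfolding maximizers_convex_hull_subset_iff[OF finite_graph_multiplihedron_vertices]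
    by (simp add: graph_multiplihedron_vertices_def)
qed

theorem graph_multiplihedron_face_poset:
  fixes b :: "'a \<Rightarrow> 'e::euclidean_space"
  assumes b: "bij_betw b (verts G) Basis"
  defines "J \<equiv> convex hull (graph_multiplihedron_vertices G b)"
  shows "polytope J" "aff_dim J = DIM('e)"
    "\<exists>\<phi>. bij_betw \<phi> (marked_tubings G) (polytope_faces J) \<and>
      (\<forall>U\<in>marked_tubings G. \<forall>U'\<in>marked_tubings G.
        marked_tubing_le G U U' \<longleftrightarrow> \<phi> U \<subseteq> \<phi> U')"
proof -
  show "polytope J"
    unfolding J_def polytope_def using finite_graph_multiplihedron_vertices by blast
  \<comment> \<open>The zero functional is maximal on all of \<open>J\<close> and has peak 0 on
    every singleton tube. Comparison with it forces \<open>w\<close> to vanish on each basis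
    vector.\<close>
  have "w = 0" if w: "maximizers w J = J" for w
  proof -
    have "maximizers 0 J \<subseteq> maximizers w J" using w by (auto simp: maximizers_def)
    then have t: "type_le (\<lambda>i. 0 \<bullet> b i) (\<lambda>i. w \<bullet> b i)"
      by (simp add: J_def maximizers_graph_multiplihedron_subset_iff)
    have "w \<bullet> b i = 0" if "i \<in> verts G" for i
    proof -
      have "sign_marking (peak (\<lambda>i. w \<bullet> b i) {i}) = sign_marking (peak (\<lambda>i. 0 \<bullet> b i) {i}) \<or>
          sign_marking (peak (\<lambda>i. w \<bullet> b i) {i}) = Broken"
        using t tube_singleton[OF that] unfolding type_le_def by meson
      then show ?thesis by (simp add: peak_def sign_marking_def split: if_splits)
    qed
    then have "\<forall>x\<in>b ` verts G. w \<bullet> x = 0" by simp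
    then have "\<forall>x\<in>Basis. w \<bullet> x = 0" unfolding bij_betw_imp_surj_on[OF b] .
    then show ?thesis using euclidean_all_zero_iff by blast
  qed
  then show "aff_dim J = DIM('e)" by (intro aff_dim_full_if_maximizers_proper) blast
  define H where "H w = height_marking G (\<lambda>i. w \<bullet> b i)" for w
  have H_marked: "marked_tubing G (H w)" for w
    unfolding H_def by (rule marked_tubing_height_marking)
  have le: "maximizers w J \<subseteq> maximizers w' J \<longleftrightarrow> marking_refines (H w) (H w')" for w w'
    unfolding J_def H_def maximizers_graph_multiplihedron_subset_iff type_le_iff_refines ..
  have "\<exists>w. H w = M" if "marked_tubing G M" for M
  proof -
    obtain c where c: "height_marking G c = M" using height_marking_surj \<open>marked_tubing G M\<close> by blast
    \<comment> \<open>The coordinates of \<open>w\<close> are read off from \<open>c\<close> through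
      the bijection between nodes and basis vectors.\<close>
    define w where "w = (\<Sum>x\<in>Basis. c (inv_into (verts G) b x) *\<^sub>R x)"
    have "w \<bullet> b i = c i" if i: "i \<in> verts G" for i
    proof -
      have "b i \<in> Basis" using bij_betwE[OF b] i by blast
      then have "w \<bullet> b i = c (inv_into (verts G) b (b i))" by (simp add: w_def)
      then show ?thesis by (simp add: bij_betw_inv_into_left[OF b i])
    qed
    then have "H w = M" unfolding H_def c[symmetric] by (rule height_marking_cong)
    then show ?thesis by blast
  qed
  then obtain W where W: "\<And>M. marked_tubing G M \<Longrightarrow> H (W M) = M" by metis
  define \<phi> where "\<phi> M = maximizers (W M) J" for M
  have \<phi>_le: "\<phi> U \<subseteq> \<phi> U' \<longleftrightarrow> marking_refines U U'" if "marked_tubing G U" "marked_tubing G U'" for U U'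
    unfolding \<phi>_def le W[OF that(1)] W[OF that(2)] ..
  have "inj_on \<phi> (marked_tubings G)"
  proof (rule inj_onI)
    fix U U' assume "U \<in> marked_tubings G" "U' \<in> marked_tubings G" "\<phi> U = \<phi> U'"
    then have "marking_refines U U'" "marking_refines U' U" using \<phi>_le[of U U'] \<phi>_le[of U' U]
      by (simp_all add: marked_tubings_def)
    then show "U = U'" by (rule refines_antisym)
  qed
  moreover have "\<phi> ` marked_tubings G = polytope_faces J"
  proof -
    have faces: "polytope_faces J = range (\<lambda>w. maximizers w J)"
      unfolding J_def
      by (rule polytope_faces_eq_maximizers[OF finite_graph_multiplihedron_vertices
            graph_multiplihedron_vertices_nonempty])
    \<comment> \<open>The functionals \<open>w\<close> and \<open>W (H w)\<close> have the same
      marked tubing, so they select the same face; hence every face is reached.\<close>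
    have "maximizers w J = \<phi> (H w)" for w
      using le[of w "W (H w)"] le[of "W (H w)" w] W[OF H_marked] refines_refl[of "H w"]
      by (simp add: \<phi>_def)
    then show ?thesis unfolding faces using H_marked by (auto simp: \<phi>_def marked_tubings_def)
  qed
  moreover have "marked_tubing_le G U U' \<longleftrightarrow> \<phi> U \<subseteq> \<phi> U'"
    if "U \<in> marked_tubings G" "U' \<in> marked_tubings G" for U U'
    using that \<phi>_le[of U U'] marked_tubing_le_iff_refines[of U' U] by (simp add: marked_tubings_def)
  ultimately show "\<exists>\<phi>. bij_betw \<phi> (marked_tubings G) (polytope_faces J) \<and>
      (\<forall>U\<in>marked_tubings G. \<forall>U'\<in>marked_tubings G.
        marked_tubing_le G U U' \<longleftrightarrow> \<phi> U \<subseteq> \<phi> U')"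
    unfolding bij_betw_def by blast
qed

end

theorem theorem6:
  fixes G :: "('a, 'b) pre_digraph" and n :: nat
  assumes "graph G" and "verts G \<noteq> {}" and "card (verts G) = n"
    and "DIM('e::euclidean_space) = n"
  shows "\<exists>J :: 'e set. polytope J \<and> aff_dim J = int n \<and>
    (\<exists>\<phi>. bij_betw \<phi> (marked_tubings G) (polytope_faces J) \<and>
      (\<forall>U\<in>marked_tubings G. \<forall>U'\<in>marked_tubings G.
        marked_tubing_le G U U' \<longleftrightarrow> \<phi> U \<subseteq> \<phi> U'))"
proof -
  interpret graph G by fact
  interpret nonempty_graph G by unfold_locales fact
  obtain b where b: "bij_betw b (verts G) (Basis :: 'e set)"
    using finite_same_card_bij[of "verts G" "Basis :: 'e set"] assms by auto
  note J = graph_multiplihedron_face_poset[OF b]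
  show ?thesis
    by (intro exI[of _ "convex hull (graph_multiplihedron_vertices G b)"] conjI J(1) J(3))
      (use J(2) assms in simp)
qed

end
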